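(* Let $H(0)$ and $H(1)$ be Hamiltonians (Hermitian operators) on the same finite-dimensional Hilbert space, and let the initial state be $\omega(0)=e^{-\beta(0)H(0)}/\mathrm{tr}(e^{-\beta(0)H(0)})$ with finite $\beta(0)>0$. There exists a quasi-static trajectory $u\mapsto H(u)$, $u\in[0,1]$, from $H(0)$ to $H(1)$ with no entropy production in the Gibbs equilibration model if and only if there exists a (finite) $\beta^*>0$ such that $$S(\omega(0))=S\!\left(\frac{e^{-\beta^*H(1)}}{\mathrm{tr}(e^{-\beta^*H(1)})}\right).$$
   Context: $S(\rho)=-\mathrm{tr}(\rho\log\rho)$ is the von Neumann entropy. Gibbs equilibration model: the equilibrium state reached from a state $\rho$ under Hamiltonian $H$ is $\Omega_{\mathrm{Gibbs}}(\rho,H)=e^{-\beta H}/\mathrm{tr}(e^{-\beta H})$ with finite inverse temperature $\beta>0$ fixed by $\mathrm{tr}(H\,\Omega_{\mathrm{Gibbs}}(\rho,H))=\mathrm{tr}(H\rho)$. Quasi-static process along a smooth trajectory $u\mapsto H(u)$: for each $N\geq 1$ put $\omega_N^{(0)}=\omega(0)$ and, for $m=1,\dots,N$, quench to $H(m/N)$ (state unchanged) and equilibrate, $\omega_N^{(m)}=\Omega_{\mathrm{Gibbs}}(\omega_N^{(m-1)},H(m/N))$; then let $N\to\infty$. It is understood that the equilibrium states are well defined in the model, i.e. the inverse temperatures of $\omega_N^{(m)}$ are positive (for all large $N$), and that the process defines limiting equilibrium states $\omega(u)=\lim_{N\to\infty}\omega_N^{(\lfloor uN\rfloor)}=e^{-\beta(u)H(u)}/\mathrm{tr}(e^{-\beta(u)H(u)})$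 with $0<\beta(u)<\infty$ for every $u\in[0,1]$. No entropy production means $S(\omega(1))=S(\omega(0))$. *)

theory Defs
  imports "HOL-Analysis.Analysis"
begin

text \<open>
  Operators on a finite-dimensional Hilbert space are written as complex square matrices
  with respect to an orthonormal basis indexed by a finite type.
\<close>

type_synonym 'n cmat = "complex ^ 'n ^ 'n"

definition adjoint_mat :: "'n::finite cmat \<Rightarrow> 'n cmat"
  where "adjoint_mat A = (\<chi> i j. cnj (A $ j $ i))"

definition hermitian :: "'n::finite cmat \<Rightarrow> bool"
  where "hermitian A \<longleftrightarrow> adjoint_mat A = A"

definition unitary :: "'n::finite cmat \<Rightarrow> bool"
  where "unitary U \<longleftrightarrow> adjoint_mat U ** U = mat 1 \<and> U ** adjoint_mat U = mat 1"

definition diag_mat :: "('n::finite \<Rightarrow> real) \<Rightarrow> 'n cmat"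
  where "diag_mat d = (\<chi> i j. if i = j then complex_of_real (d i) else 0)"

primrec matpow :: "'n::finite cmat \<Rightarrow> nat \<Rightarrow> 'n cmat"
  where
    "matpow A 0 = mat 1"
  | "matpow A (Suc k) = A ** matpow A k"

text \<open>
  Square matrices are not an instance of the type class on which the library exponential is
  defined (their \<open>*\<close> is componentwise), hence the explicit power series;
  \<open>matexp_sums\<close> below shows that it always converges.
\<close>

definition matexp :: "'n::finite cmat \<Rightarrow> 'n cmat"
  where "matexp A = (\<Sum>k. (1 / fact k) *\<^sub>R matpow A k)"

text \<open>
  Spectral functional calculus for Hermitian matrices. By \<open>matfun_eq\<close> below the value does not
  depend on the choice of the diagonalization.
\<close>

definition matfun :: "(real \<Rightarrow> real) \<Rightarrow> 'n::finite cmat \<Rightarrow> 'n cmat"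
  where "matfun f A =
    (THE B. \<exists>U d. unitary U \<and> A = U ** diag_mat d ** adjoint_mat U
                 \<and> B = U ** diag_mat (f \<circ> d) ** adjoint_mat U)"

text \<open>
  Since \<open>ln 0 = 0\<close>, the convention \<open>0 log 0 = 0\<close> is respected. For Hermitian \<open>\<rho>\<close> the trace is a
  real number, so \<open>Re\<close> only changes the type.
\<close>

definition vn_entropy :: "'n::finite cmat \<Rightarrow> real"
  where "vn_entropy \<rho> = - Re (trace (\<rho> ** matfun ln \<rho>))"

definition gibbs :: "real \<Rightarrow> 'n::finite cmat \<Rightarrow> 'n cmat"
  where "gibbs \<beta> H =
    (let E = matexp ((- \<beta>) *\<^sub>R H) in map_matrix (\<lambda>z. z / trace E) E)"

definition equilibrium_beta :: "'n::finite cmat \<Rightarrow> 'n cmat \<Rightarrow> real \<Rightarrow> bool"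
  where "equilibrium_beta \<rho> H \<beta> \<longleftrightarrow>
    0 < \<beta> \<and> trace (H ** gibbs \<beta> H) = trace (H ** \<rho>)"

text \<open>
  If \<open>H\<close> is not a multiple of the identity, at most one \<open>\<beta>\<close> satisfies the energy condition; if it
  is, every \<open>\<beta>\<close> does (for \<open>\<rho>\<close> of trace 1) but all of them give the same Gibbs state. Hence
  the value does not depend on the choice whenever a positive inverse temperature exists;
  otherwise it carries no meaning, which is why \<open>gibbs_process_well_defined\<close> is required
  wherever it is used.
\<close>

definition Omega_Gibbs :: "'n::finite cmat \<Rightarrow> 'n cmat \<Rightarrow> 'n cmat"
  where "Omega_Gibbs \<rho> H = gibbs (SOME \<beta>. equilibrium_beta \<rho> H \<beta>) H"

text \<open>\<open>gibbs_process H \<omega>0 N m\<close> is the state after \<open>m\<close> of the \<open>N\<close> quench-and-equilibrate steps.\<close>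

primrec gibbs_process ::
    "(real \<Rightarrow> 'n::finite cmat) \<Rightarrow> 'n cmat \<Rightarrow> nat \<Rightarrow> nat \<Rightarrow> 'n cmat"
  where
    "gibbs_process H \<omega>0 N 0 = \<omega>0"
  | "gibbs_process H \<omega>0 N (Suc m) =
       Omega_Gibbs (gibbs_process H \<omega>0 N m) (H (real (Suc m) / real N))"

definition gibbs_process_well_defined ::
    "(real \<Rightarrow> 'n::finite cmat) \<Rightarrow> 'n cmat \<Rightarrow> nat \<Rightarrow> bool"
  where "gibbs_process_well_defined H \<omega>0 N \<longleftrightarrow>
    (\<forall>m<N. \<exists>\<beta>. equilibrium_beta (gibbs_process H \<omega>0 N m) (H (real (Suc m) / real N)) \<beta>)"

text \<open>Derivatives of all orders on the closed unit interval, one-sided at its end points.\<close>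

definition smooth_on_unit :: "(real \<Rightarrow> 'a::real_normed_vector) \<Rightarrow> bool"
  where "smooth_on_unit f \<longleftrightarrow>
    (\<exists>D. (\<forall>u\<in>{0..1}. D 0 u = f u) \<and>
         (\<forall>k::nat. \<forall>u\<in>{0..1}. (D k has_vector_derivative D (Suc k) u) (at u within {0..1})))"

text \<open>
  \<open>H\<close> is a smooth trajectory of Hamiltonians whose quasi-static process, started in \<open>\<omega>0\<close>, has
  the limiting equilibrium states \<open>\<omega> u\<close>.
\<close>

definition quasi_static ::
    "(real \<Rightarrow> 'n::finite cmat) \<Rightarrow> 'n cmat \<Rightarrow> (real \<Rightarrow> 'n cmat) \<Rightarrow> bool"
  where "quasi_static H \<omega>0 \<omega> \<longleftrightarrow>
    smooth_on_unit H \<and>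
    (\<forall>u\<in>{0..1}. hermitian (H u)) \<and>
    (\<forall>\<^sub>F N in sequentially. gibbs_process_well_defined H \<omega>0 N) \<and>
    (\<forall>u\<in>{0..1}.
       (\<lambda>N. gibbs_process H \<omega>0 N (nat \<lfloor>u * real N\<rfloor>)) \<longlonglongrightarrow> \<omega> u \<and>
       (\<exists>\<beta>>0. \<omega> u = gibbs \<beta> (H u)))"

definition no_entropy_production :: "(real \<Rightarrow> 'n::finite cmat) \<Rightarrow> bool"
  where "no_entropy_production \<omega> \<longleftrightarrow> vn_entropy (\<omega> 1) = vn_entropy (\<omega> 0)"

lemma matexp_sums:
  fixes A :: "'n::finite cmat"
  shows "(\<lambda>k. (1 / fact k) *\<^sub>R matpow A k) sums matexp A"
proof -
  have "bilinear (\<lambda>(A :: 'n cmat) (B :: 'n cmat). A ** B)"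
    unfolding bilinear_def
    by (auto intro!: linearI
        simp: matrix_matrix_mult_def vec_eq_iff
          sum.distrib distrib_right distrib_left scaleR_sum_right)
  then have "bounded_bilinear (\<lambda>(A :: 'n cmat) (B :: 'n cmat). A ** B)"
    by (simp add: bilinear_conv_bounded_bilinear)
  then obtain K where K: "K > 0" "\<And>(A :: 'n cmat) (B :: 'n cmat). norm (A ** B) \<le> norm A * norm B * K"
    using bounded_bilinear.pos_bounded by blast
  have pow: "norm (matpow A k) \<le> (norm A * K) ^ k * norm (mat 1 :: 'n cmat)" for k
  proof (induction k)
    case (Suc k)
    have "norm (matpow A (Suc k)) \<le> norm A * K * norm (matpow A k)"
      using K(2)[of A "matpow A k"] by (simp add: mult_ac)
    also have "\<dots> \<le> norm A * K * ((norm A * K) ^ k * norm (mat 1 :: 'n cmat))"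
      using Suc K(1) by (intro mult_left_mono) auto
    finally show ?case by (simp add: mult_ac)
  qed simp
  have "summable (\<lambda>k. inverse (fact k) * (norm A * K) ^ k * norm (mat 1 :: 'n cmat))"
    by (intro summable_mult2 summable_exp)
  moreover have "norm ((1 / fact k) *\<^sub>R matpow A k)
      \<le> inverse (fact k) * (norm A * K) ^ k * norm (mat 1 :: 'n cmat)" for k
    using mult_left_mono[OF pow[of k], of "inverse (fact k)"]
    by (simp add: divide_inverse mult_ac)
  ultimately have "summable (\<lambda>k. (1 / fact k) *\<^sub>R matpow A k)"
    by (rule summable_comparison_test')
  then show ?thesis
    unfolding matexp_def by (rule summable_sums)
qed

lemma diag_mat_mult_nth:
  fixes W :: "'n::finite cmat"
  shows "(W ** diag_mat d) $ i $ j = W $ i $ j * complex_of_real (d j)"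
    and "(diag_mat d ** W) $ i $ j = complex_of_real (d i) * W $ i $ j"
  by (simp_all add: matrix_matrix_mult_def diag_mat_def if_distrib if_distribR cong: if_cong)

lemma matfun_unique:
  fixes U V :: "'n::finite cmat"
  assumes U: "unitary U" and V: "unitary V"
    and eq: "U ** diag_mat d ** adjoint_mat U = V ** diag_mat e ** adjoint_mat V"
  shows "U ** diag_mat (f \<circ> d) ** adjoint_mat U = V ** diag_mat (f \<circ> e) ** adjoint_mat V"
proof -
  define W where "W = adjoint_mat V ** U"
  have UU: "adjoint_mat U ** U = mat 1" "U ** adjoint_mat U = mat 1"
    and VV: "adjoint_mat V ** V = mat 1" "V ** adjoint_mat V = mat 1"
    using U V by (auto simp: unitary_def)
  have "W ** diag_mat d = adjoint_mat V ** (U ** diag_mat d ** adjoint_mat U) ** U"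
    by (simp add: W_def UU matrix_mul_assoc[symmetric])
  also have "\<dots> = adjoint_mat V ** (V ** diag_mat e ** adjoint_mat V) ** U"
    by (simp add: eq)
  also have "\<dots> = diag_mat e ** W"
    by (simp add: W_def VV matrix_mul_assoc)
  finally have comm: "W ** diag_mat d = diag_mat e ** W" .
  have "W $ i $ j * complex_of_real (f (d j)) = complex_of_real (f (e i)) * W $ i $ j" for i j
  proof -
    have "W $ i $ j * complex_of_real (d j) = complex_of_real (e i) * W $ i $ j"
      using arg_cong[OF comm, of "\<lambda>M. M $ i $ j"] by (simp add: diag_mat_mult_nth)
    then show ?thesis
      by (cases "W $ i $ j = 0") (auto simp: mult.commute)
  qed
  then have "W ** diag_mat (f \<circ> d) = diag_mat (f \<circ> e) ** W"
    by (simp add: vec_eq_iff diag_mat_mult_nth)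
  then have "V ** (W ** diag_mat (f \<circ> d)) ** adjoint_mat U
      = V ** (diag_mat (f \<circ> e) ** W) ** adjoint_mat U"
    by simp
  moreover have "V ** (W ** diag_mat (f \<circ> d)) ** adjoint_mat U
      = U ** diag_mat (f \<circ> d) ** adjoint_mat U"
    by (simp add: W_def VV matrix_mul_assoc)
  moreover have "V ** (diag_mat (f \<circ> e) ** W) ** adjoint_mat U
      = V ** diag_mat (f \<circ> e) ** adjoint_mat V"
    by (simp add: W_def UU matrix_mul_assoc[symmetric])
  ultimately show ?thesis by simp
qed

lemma matfun_eq:
  assumes "unitary U"
  shows "matfun f (U ** diag_mat d ** adjoint_mat U) = U ** diag_mat (f \<circ> d) ** adjoint_mat U"
  unfolding matfun_def
proof (rule the_equality)
  show "\<exists>V e. unitary V \<and> U ** diag_mat d ** adjoint_mat U = V ** diag_mat e ** adjoint_mat V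
      \<and> U ** diag_mat (f \<circ> d) ** adjoint_mat U = V ** diag_mat (f \<circ> e) ** adjoint_mat V"
    using assms by blast
next
  fix B
  assume "\<exists>V e. unitary V \<and> U ** diag_mat d ** adjoint_mat U = V ** diag_mat e ** adjoint_mat V
      \<and> B = V ** diag_mat (f \<circ> e) ** adjoint_mat V"
  then show "B = U ** diag_mat (f \<circ> d) ** adjoint_mat U"
    using matfun_unique[OF assms] by metis
qed

end

theory Submission
  imports Defs "HOL-Real_Asymp.Real_Asymp"
begin

text \<open>
  Only the existence of an isentropic trajectory needs work. The Gibbs variational inequality shows
  that one quench-and-equilibrate step from \<open>gibbs b (H u)\<close> to \<open>H v\<close> does not lower the entropy,
  and raises it by at most the trace of \<open>b (H v - H u)\<close> against
  \<open>gibbs b (H u) - gibbs b (H v)\<close>. Both factors tend to zero with the step size, the first one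
  linearly, so the total entropy production vanishes in the limit. As the entropy of
  \<open>gibbs b (H u)\<close> is strictly decreasing in \<open>b \<ge> 0\<close>, the process then converges at every \<open>u\<close> to
  the unique Gibbs state of \<open>H u\<close> with the initial entropy \<open>s\<close>, provided that such states exist.

  The latter holds along the trajectory
  \<open>(1 - u) H0 + u H1 - c u (1 - u) |\<psi> u\<rangle>\<langle>\<psi> u|\<close> with \<open>\<psi> u = (1 - u) \<psi>0 + u \<psi>1\<close>, where \<open>\<psi>0\<close>, \<open>\<psi>1\<close>
  are ground states of \<open>H0\<close>, \<open>H1\<close> and \<open>c\<close> is large: for \<open>0 < u < 1\<close> the rank-one term makes the
  ground state non-degenerate, so that the Gibbs entropy tends to \<open>0\<close> as the inverse temperature
  tends to infinity. This settles the case \<open>s < ln n\<close>; if \<open>s = ln n\<close>, then \<open>H0\<close> and \<open>H1\<close> are scalar.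
\<close>

section \<open>Spectral theorem for Hermitian matrices\<close>

lemma adjoint_mat_nth [simp]: "adjoint_mat A $ i $ j = cnj (A $ j $ i)"
  by (simp add: adjoint_mat_def)

lemma adjoint_mat_mult: "adjoint_mat (A ** B) = adjoint_mat B ** adjoint_mat A"
  by (simp add: vec_eq_iff matrix_matrix_mult_def mult.commute)

lemma adjoint_mat_adjoint [simp]: "adjoint_mat (adjoint_mat A) = A"
  by (simp add: vec_eq_iff)

lemma adjoint_mat_diag [simp]: "adjoint_mat (diag_mat d) = diag_mat d"
  by (simp add: vec_eq_iff diag_mat_def)

text \<open>The \<open>inner\<close> of complex vectors is the real inner product, which is the real
  part of this one. Rayleigh quotients below use the real product, orthogonality of eigenvectors the
  complex one.\<close>

definition hinner :: "complex ^ 'n::finite \<Rightarrow> complex ^ 'n \<Rightarrow> complex"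
  where "hinner x y = (\<Sum>i\<in>UNIV. cnj (x $ i) * y $ i)"

lemma hinner_add_right: "hinner x (y + z) = hinner x y + hinner x z"
  by (simp add: hinner_def distrib_left sum.distrib)

lemma hinner_scale_right: "hinner x (c *s y) = c * hinner x y"
  by (simp add: hinner_def sum_distrib_left mult_ac)

lemma hinner_scale_left: "hinner (c *s x) y = cnj c * hinner x y"
  by (simp add: hinner_def sum_distrib_left mult_ac)

lemma scaleR_eq_scalar_mult: "r *\<^sub>R x = complex_of_real r *s (x :: complex ^ 'n)"
  unfolding vec_eq_iff vector_scaleR_component vector_smult_component
  by (simp add: scaleR_conv_of_real)

lemma matrix_vector_mult_scaleR: "A *v (r *\<^sub>R x) = r *\<^sub>R (A *v x)"
  for A :: "complex ^ 'n::finite ^ 'm"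
  unfolding scaleR_eq_scalar_mult by (rule vector_scalar_commute)

lemma hinner_scaleR_right: "hinner x (r *\<^sub>R y) = of_real r * hinner x y"
  by (simp add: scaleR_eq_scalar_mult hinner_scale_right)

lemma cnj_hinner: "cnj (hinner x y) = hinner y x"
  by (simp add: hinner_def mult.commute)

lemma inner_eq_Re_hinner: "inner x y = Re (hinner x y)"
  by (simp add: hinner_def inner_vec_def inner_complex_def)

lemma hinner_self: "hinner x x = of_real ((norm x)\<^sup>2)"
proof -
  have "hinner x x \<in> \<real>"
    by (metis cnj_hinner Reals_cnj_iff)
  then show ?thesis
    by (metis inner_eq_Re_hinner power2_norm_eq_inner of_real_Re)
qed

lemma hinner_adjoint: "hinner x (A *v y) = hinner (adjoint_mat A *v x) y"
proof -
  have "hinner x (A *v y) = (\<Sum>i\<in>UNIV. \<Sum>j\<in>UNIV. cnj (x $ i) * A $ i $ j * y $ j)"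
    by (simp add: hinner_def matrix_vector_mult_def sum_distrib_left mult.assoc)
  also have "\<dots> = (\<Sum>j\<in>UNIV. \<Sum>i\<in>UNIV. cnj (x $ i) * A $ i $ j * y $ j)"
    by (rule sum.swap)
  also have "\<dots> = hinner (adjoint_mat A *v x) y"
    by (simp add: hinner_def matrix_vector_mult_def sum_distrib_left sum_distrib_right mult_ac)
  finally show ?thesis .
qed

lemma hinner_hermitian: "hermitian A \<Longrightarrow> hinner x (A *v y) = hinner (A *v x) y"
  using hinner_adjoint[of x A y] by (simp add: hermitian_def)

text \<open>The complex orthogonal complement \<open>W\<close> of a set of eigenvectors is invariant
  under \<open>A\<close>, and it is nonzero because \<open>S\<close> has too few elements to span
  the space. A maximizer of the Rayleigh quotient on the unit sphere of \<open>W\<close> is an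
  eigenvector.\<close>

lemma hermitian_eigenvector_orthogonal:
  fixes A :: "'n::finite cmat"
  assumes A: "hermitian A" and S: "finite S" "card S < CARD('n)"
    and ev: "\<And>v. v \<in> S \<Longrightarrow> \<exists>l::real. A *v v = l *\<^sub>R v"
  shows "\<exists>x (l::real). norm x = 1 \<and> A *v x = l *\<^sub>R x \<and> (\<forall>v\<in>S. hinner v x = 0)"
proof -
  \<comment> \<open>Complex orthogonality to \<open>S\<close> is real orthogonality to \<open>T\<close>, so the real theory of subspaces applies.\<close>
  define T where "T = S \<union> (\<lambda>v. \<i> *s v) ` S"
  define W where "W = {x. \<forall>v\<in>S. hinner v x = 0}"
  have "card T \<le> card S + card S"
    unfolding T_def by (meson add_left_mono card_Un_le card_image_le S(1) order_trans)
  moreover have "dim (span T) \<le> card T"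
    using S(1) by (auto intro!: dim_le_card span_superset simp: T_def)
  \<comment> \<open>The real dimension of \<open>complex ^ 'n\<close> is
    \<open>2 * CARD('n)\<close>, and \<open>T\<close> has at most \<open>2 * card S\<close>
    elements.\<close>
  ultimately have "dim (span T) < DIM(complex ^ 'n)"
    using S(2) by simp
  then obtain y where y: "y \<noteq> 0" "\<And>z. z \<in> span T \<Longrightarrow> orthogonal y z"
    by (metis dim_span orthogonal_to_subspace_exists)
  have "hinner v y = 0" if "v \<in> S" for v
  proof -
    have "inner y v = 0" "inner y (\<i> *s v) = 0"
      using y(2)[of v] y(2)[of "\<i> *s v"] that
      by (auto simp: orthogonal_def T_def intro!: span_base)
    then have "Re (hinner v y) = 0" "Re (hinner (\<i> *s v) y) = 0"
      by (metis inner_eq_Re_hinner inner_commute)+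
    then show ?thesis
      by (simp add: hinner_scale_left complex_eq_iff)
  qed
  then have yW: "y \<in> W"
    by (simp add: W_def)
  have W_add: "a + b \<in> W" if "a \<in> W" "b \<in> W" for a b
    using that by (simp add: W_def hinner_add_right)
  have W_scale: "r *\<^sub>R a \<in> W" if "a \<in> W" for r a
    using that by (simp add: W_def hinner_scaleR_right)
  have W_A: "A *v a \<in> W" if "a \<in> W" for a
    unfolding W_def
  proof safe
    fix v assume v: "v \<in> S"
    obtain l :: real where "A *v v = l *\<^sub>R v" using ev[OF v] by blast
    then show "hinner v (A *v a) = 0"
      using that v by (simp add: hinner_hermitian[OF A] scaleR_eq_scalar_mult hinner_scale_left W_def)
  qed
  have "W = (\<Inter>v\<in>S. {x. hinner v x = 0})"
    by (auto simp: W_def)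
  moreover have "closed {x. hinner v x = 0}" for v :: "complex ^ 'n"
    unfolding hinner_def by (intro closed_Collect_eq continuous_intros)
  ultimately have "closed W"
    by auto
  then have cpt: "compact (W \<inter> sphere 0 1)"
    by (intro closed_Int_compact) auto
  have "y /\<^sub>R norm y \<in> W \<inter> sphere 0 1"
    using y(1) W_scale[OF yW] by simp
  then have ne: "W \<inter> sphere 0 1 \<noteq> {}"
    by blast
  have "continuous_on (W \<inter> sphere 0 1) (\<lambda>x. inner x (A *v x))"
    unfolding matrix_vector_mult_def by (intro continuous_intros)
  from continuous_attains_sup[OF cpt ne this]
  obtain x where x: "x \<in> W" "norm x = 1"
    and max: "\<And>z. z \<in> W \<Longrightarrow> norm z = 1 \<Longrightarrow> inner z (A *v z) \<le> inner x (A *v x)"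
    by auto
  \<comment> \<open>\<open>x\<close> maximizes the Rayleigh quotient on \<open>W\<close>; the first variation in the direction \<open>w\<close> below forces \<open>w = 0\<close>.\<close>
  define l where "l = inner x (A *v x)"
  have bound: "inner z (A *v z) \<le> l * inner z z" if "z \<in> W" for z
  proof (cases "z = 0")
    case False
    define r where "r = 1 / norm z"
    have "inner (r *\<^sub>R z) (A *v (r *\<^sub>R z)) \<le> l"
      unfolding l_def r_def using False W_scale[OF that] by (intro max) auto
    moreover have "inner (r *\<^sub>R z) (A *v (r *\<^sub>R z)) = r\<^sup>2 * inner z (A *v z)"
      by (simp add: matrix_vector_mult_scaleR power2_eq_square)
    moreover have "r\<^sup>2 = 1 / inner z z"
      by (simp add: r_def power_divide power2_norm_eq_inner)
    ultimately have "1 / inner z z * inner z (A *v z) \<le> l"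
      by simp
    then show ?thesis
      using False by (simp add: divide_le_eq)
  qed simp
  define w where "w = l *\<^sub>R x - A *v x"
  have wW: "w \<in> W"
    using W_add[OF W_scale[OF x(1), of l] W_scale[OF W_A[OF x(1)], of "-1"]] by (simp add: w_def)
  have sym: "inner a (A *v b) = inner b (A *v a)" for a b
    by (metis hinner_hermitian[OF A] inner_commute inner_eq_Re_hinner)
  \<comment> \<open>This is \<open>bound\<close> at \<open>x + t *\<^sub>R w\<close>. The terms of
    order zero cancel, and by the choice of \<open>w\<close> the linear coefficient becomes
    \<open>2 * inner w w\<close>.\<close>
  have quad: "0 \<le> 2 * t * inner w w + t\<^sup>2 * (l * inner w w - inner w (A *v w))" for t
  proof -
    have "x + t *\<^sub>R w \<in> W"
      using W_add x(1) W_scale wW by blast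
    then have le: "inner (x + t *\<^sub>R w) (A *v (x + t *\<^sub>R w)) \<le> l * inner (x + t *\<^sub>R w) (x + t *\<^sub>R w)"
      by (rule bound)
    have e1: "inner (x + t *\<^sub>R w) (A *v (x + t *\<^sub>R w))
        = l + 2 * (t * inner w (A *v x)) + t\<^sup>2 * inner w (A *v w)"
      using sym[of x w]
      by (simp add: matrix_vector_right_distrib matrix_vector_mult_scaleR inner_add_left
          inner_add_right l_def power2_eq_square algebra_simps)
    have e2: "inner (x + t *\<^sub>R w) (x + t *\<^sub>R w) = 1 + 2 * (t * inner x w) + t\<^sup>2 * inner w w"
      using x(2) inner_commute[of w x] norm_eq_1[of x]
      by (simp add: inner_add_left inner_add_right power2_eq_square algebra_simps)
    have e3: "t * inner w w = t * (l * inner x w) - t * inner w (A *v x)"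
      by (simp add: w_def inner_diff_left inner_diff_right inner_commute algebra_simps)
    show ?thesis
      using le[unfolded e1 e2] e3 by (simp add: algebra_simps)
  qed
  have "w = 0"
  proof (rule ccontr)
    assume "w \<noteq> 0"
    then have ww: "inner w w > 0" by simp
    define c where "c = \<bar>l * inner w w - inner w (A *v w)\<bar> + 1"
    have c: "c > 0" "l * inner w w - inner w (A *v w) < c" by (auto simp: c_def)
    \<comment> \<open>This \<open>t\<close> minimizes
      \<open>2 * t * inner w w + t\<^sup>2 * c\<close>.\<close>
    define t where "t = - (inner w w / c)"
    have "t\<^sup>2 * (l * inner w w - inner w (A *v w)) \<le> t\<^sup>2 * c"
      using c by (intro mult_left_mono) auto
    with quad[of t] have "0 \<le> 2 * t * inner w w + t\<^sup>2 * c" by linarith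
    also have "\<dots> = - (inner w w)\<^sup>2 / c"
      using c by (simp add: t_def power2_eq_square field_simps)
    also have "\<dots> < 0" using ww c by simp
    finally show False by simp
  qed
  then have "A *v x = l *\<^sub>R x" by (simp add: w_def)
  then show ?thesis using x by (auto simp: W_def)
qed

text \<open>The previous lemma adds one eigenvector at a time to the empty set until there are
  \<open>CARD('n)\<close> of them; these orthonormal eigenvectors are the columns of
  \<open>U\<close>.\<close>

lemma hermitian_diagonalization:
  fixes A :: "'n::finite cmat"
  assumes A: "hermitian A"
  obtains U d where "unitary U" "A = U ** diag_mat d ** adjoint_mat U"
proof -
  have "\<exists>S. finite S \<and> card S = k \<and> (\<forall>v\<in>S. norm v = 1 \<and> (\<exists>l::real. A *v v = l *\<^sub>R v))
      \<and> (\<forall>v\<in>S. \<forall>w\<in>S. v \<noteq> w \<longrightarrow> hinner v w = 0)" if "k \<le> CARD('n)" for k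
    using that
  proof (induction k)
    case 0
    then show ?case by (intro exI[of _ "{}"]) auto
  next
    case (Suc k)
    then obtain S where S: "finite S" "card S = k"
      "\<And>v. v \<in> S \<Longrightarrow> norm v = 1 \<and> (\<exists>l::real. A *v v = l *\<^sub>R v)"
      "\<And>v w. v \<in> S \<Longrightarrow> w \<in> S \<Longrightarrow> v \<noteq> w \<Longrightarrow> hinner v w = 0"
      by auto
    obtain x and l :: real where x: "norm x = 1" "A *v x = l *\<^sub>R x" "\<And>v. v \<in> S \<Longrightarrow> hinner v x = 0"
      using hermitian_eigenvector_orthogonal[OF A S(1)] S(2,3) Suc.prems by (metis Suc_le_eq)
    have "x \<notin> S"
    proof
      assume "x \<in> S"
      then have "hinner x x = 0" by (rule x(3))
      with x(1) show False by (simp add: hinner_self)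
    qed
    moreover have "hinner x v = 0" if "v \<in> S" for v
      using x(3)[OF that] cnj_hinner[of v x] by simp
    ultimately show ?case
      using S x by (intro exI[of _ "insert x S"]) auto
  qed
  from this[OF order_refl] obtain S where S: "finite S" "card S = CARD('n)"
      "\<And>v. v \<in> S \<Longrightarrow> norm v = 1" "\<And>v. v \<in> S \<Longrightarrow> \<exists>l::real. A *v v = l *\<^sub>R v"
      "\<And>v w. v \<in> S \<Longrightarrow> w \<in> S \<Longrightarrow> v \<noteq> w \<Longrightarrow> hinner v w = 0"
    by auto
  obtain f where f: "bij_betw f (UNIV :: 'n set) S"
    using S(1,2) finite_same_card_bij[of "UNIV :: 'n set" S] by auto
  have fS: "f i \<in> S" for i using f by (auto simp: bij_betw_def)
  have "\<forall>i. \<exists>l::real. A *v f i = l *\<^sub>R f i" using S(4) fS by blast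
  then obtain d :: "'n \<Rightarrow> real" where d: "\<And>i. A *v f i = d i *\<^sub>R f i" by metis
  define U :: "'n cmat" where "U = (\<chi> i j. f j $ i)"
  have ort: "hinner (f i) (f j) = (if i = j then 1 else 0)" for i j
  proof (cases "i = j")
    case True
    then show ?thesis using S(3)[OF fS] by (simp add: hinner_self)
  next
    case False
    then have "f i \<noteq> f j" using f by (auto simp: bij_betw_def inj_on_def)
    then show ?thesis using S(5)[OF fS fS] False by simp
  qed
  have UU: "adjoint_mat U ** U = mat 1"
    using ort by (simp add: vec_eq_iff matrix_matrix_mult_def U_def hinner_def mat_def)
  then have un: "unitary U"
    unfolding unitary_def using matrix_left_right_inverse by blast
  have "(A ** U) $ i $ j = (U ** diag_mat d) $ i $ j" for i j
  proof -
    have "(A ** U) $ i $ j = (A *v f j) $ i"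
      by (simp add: matrix_matrix_mult_def matrix_vector_mult_def U_def)
    also have "\<dots> = (U ** diag_mat d) $ i $ j"
      by (simp add: d diag_mat_mult_nth U_def scaleR_eq_scalar_mult mult.commute)
    finally show ?thesis .
  qed
  then have "A ** U = U ** diag_mat d" by (simp add: vec_eq_iff)
  then have "A ** U ** adjoint_mat U = U ** diag_mat d ** adjoint_mat U" by simp
  then have "A = U ** diag_mat d ** adjoint_mat U"
    using un by (simp add: unitary_def matrix_mul_assoc[symmetric])
  with un show ?thesis by (rule that)
qed

section \<open>Gibbs states and the variational inequality\<close>

lemma unitaryD:
  assumes "unitary U"
  shows "adjoint_mat U ** U = mat 1" "U ** adjoint_mat U = mat 1"
  using assms by (auto simp: unitary_def)

lemma diag_mat_mult: "diag_mat a ** diag_mat b = diag_mat (\<lambda>i. a i * b i)"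
  by (simp add: vec_eq_iff diag_mat_mult_nth) (simp add: diag_mat_def)

lemma matrix_scaleR_mult: "(c *\<^sub>R A) ** B = c *\<^sub>R (A ** B)"
  for A B :: "'n::finite cmat"
  by (simp add: vec_eq_iff matrix_matrix_mult_def scaleR_sum_right)

lemma matrix_mult_scaleR: "A ** (c *\<^sub>R B) = c *\<^sub>R (A ** B)"
  for A B :: "'n::finite cmat"
  by (simp add: vec_eq_iff matrix_matrix_mult_def scaleR_sum_right)

lemma scaleR_diag_mat: "c *\<^sub>R diag_mat d = diag_mat (\<lambda>i. c * d i)"
proof -
  have "(c *\<^sub>R diag_mat d) $ i $ j = diag_mat (\<lambda>i. c * d i) $ i $ j" for i j
    unfolding vector_scaleR_component diag_mat_def by (simp add: scaleR_conv_of_real)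
  then show ?thesis unfolding vec_eq_iff by blast
qed

lemma conj_mult:
  assumes "unitary U"
  shows "(U ** A ** adjoint_mat U) ** (U ** B ** adjoint_mat U) = U ** (A ** B) ** adjoint_mat U"
proof -
  have "(U ** A ** adjoint_mat U) ** (U ** B ** adjoint_mat U)
      = U ** A ** (adjoint_mat U ** U) ** B ** adjoint_mat U"
    by (simp only: matrix_mul_assoc)
  also have "\<dots> = U ** (A ** B) ** adjoint_mat U"
    by (simp add: unitaryD[OF assms] matrix_mul_assoc)
  finally show ?thesis .
qed

lemma diag_mat_one: "diag_mat (\<lambda>i. 1) = (mat 1 :: 'n::finite cmat)"
  by (simp add: vec_eq_iff diag_mat_def mat_def)

lemma matpow_conj_diag:
  assumes "unitary U"
  shows "matpow (U ** diag_mat d ** adjoint_mat U) k = U ** diag_mat (\<lambda>i. d i ^ k) ** adjoint_mat U"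
proof (induction k)
  case 0
  show ?case by (simp add: unitaryD[OF assms] diag_mat_one)
next
  case (Suc k)
  then show ?case by (simp add: conj_mult[OF assms] diag_mat_mult)
qed

lemma conj_diag_nth:
  "(U ** diag_mat d ** adjoint_mat U) $ i $ j
    = (\<Sum>k\<in>UNIV. U $ i $ k * complex_of_real (d k) * cnj (U $ j $ k))"
  by (simp add: matrix_matrix_mult_def[of "U ** diag_mat d"] diag_mat_mult_nth)

lemma sums_vec_nth:
  fixes f :: "nat \<Rightarrow> 'a::real_normed_vector ^ 'n"
  shows "f sums s \<Longrightarrow> (\<lambda>k. f k $ i) sums (s $ i)"
  by (rule bounded_linear.sums[OF bounded_linear_vec_nth])

text \<open>Entrywise, the power series is a finite combination of the scalar exponential series of
  the eigenvalues.\<close>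

lemma matexp_conj_diag:
  assumes "unitary U"
  shows "matexp (U ** diag_mat d ** adjoint_mat U) = U ** diag_mat (\<lambda>i. exp (d i)) ** adjoint_mat U"
    (is "matexp ?A = ?B")
proof -
  have "matexp ?A $ i $ j = ?B $ i $ j" for i j
  proof -
    have "(\<lambda>k. ((1 / fact k) *\<^sub>R matpow ?A k) $ i $ j) sums (matexp ?A $ i $ j)"
      by (intro sums_vec_nth matexp_sums)
    moreover have "(\<lambda>k. ((1 / fact k) *\<^sub>R matpow ?A k) $ i $ j) sums (?B $ i $ j)"
    proof -
      have "(\<lambda>k. \<Sum>l\<in>UNIV. U $ i $ l * complex_of_real (d l ^ k /\<^sub>R fact k) * cnj (U $ j $ l))
          sums (\<Sum>l\<in>UNIV. U $ i $ l * complex_of_real (exp (d l)) * cnj (U $ j $ l))"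
        by (intro sums_sum sums_mult sums_mult2 sums_of_real exp_converges)
      moreover have "((1 / fact k) *\<^sub>R matpow ?A k) $ i $ j
          = (\<Sum>l\<in>UNIV. U $ i $ l * complex_of_real (d l ^ k /\<^sub>R fact k) * cnj (U $ j $ l))" for k
        unfolding vector_scaleR_component matpow_conj_diag[OF assms] conj_diag_nth
        by (simp add: scaleR_conv_of_real sum_distrib_left sum_divide_distrib field_simps)
      ultimately show ?thesis
        by (simp add: conj_diag_nth)
    qed
    ultimately show ?thesis
      by (rule sums_unique2)
  qed
  then show ?thesis by (simp add: vec_eq_iff)
qed

lemma trace_diag_mat: "trace (diag_mat d) = complex_of_real (\<Sum>i\<in>UNIV. d i)"
  by (simp add: trace_def diag_mat_def)

lemma trace_conj:
  fixes A :: "'n::finite cmat"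
  assumes "unitary U"
  shows "trace (U ** A ** adjoint_mat U) = trace A"
  by (metis assms matrix_mul_assoc matrix_mul_rid trace_mul_sym unitaryD(1))

lemma scaleR_conj_diag:
  "c *\<^sub>R (U ** diag_mat d ** adjoint_mat U) = U ** diag_mat (\<lambda>i. c * d i) ** adjoint_mat U"
  by (simp only: scaleR_diag_mat[symmetric] matrix_scaleR_mult matrix_mult_scaleR)

section \<open>Weights, energies and entropies of Gibbs states in an eigenbasis\<close>

definition boltzmann :: "real \<Rightarrow> ('n::finite \<Rightarrow> real) \<Rightarrow> 'n \<Rightarrow> real"
  where "boltzmann \<beta> d i = exp (- \<beta> * d i) / (\<Sum>j\<in>UNIV. exp (- \<beta> * d j))"

definition partition_fun :: "real \<Rightarrow> 'n::finite cmat \<Rightarrow> real"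
  where "partition_fun \<beta> H = Re (trace (matexp ((- \<beta>) *\<^sub>R H)))"

text \<open>For Hermitian \<open>A\<close> and a Gibbs state of a Hermitian matrix the trace is
  already real, see \<open>trace_mult_gibbs\<close>, so \<open>Re\<close> only changes the type
  there.\<close>

definition energy :: "'n::finite cmat \<Rightarrow> 'n cmat \<Rightarrow> real"
  where "energy A \<rho> = Re (trace (A ** \<rho>))"

lemma boltzmann_pos: "0 < boltzmann \<beta> d i"
  by (simp add: boltzmann_def sum_pos)

lemma sum_boltzmann: "(\<Sum>i\<in>UNIV. boltzmann \<beta> d i) = 1"
proof -
  have "(\<Sum>j\<in>UNIV. exp (- \<beta> * d j)) > 0"
    by (simp add: sum_pos)
  then show ?thesis
    by (simp add: boltzmann_def sum_divide_distrib[symmetric])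
qed

lemma matexp_scaleR_conj_diag:
  assumes "unitary U"
  shows "matexp ((- \<beta>) *\<^sub>R (U ** diag_mat d ** adjoint_mat U))
    = U ** diag_mat (\<lambda>i. exp (- \<beta> * d i)) ** adjoint_mat U"
  unfolding scaleR_conj_diag by (rule matexp_conj_diag[OF assms])

lemma partition_fun_conj_diag:
  assumes "unitary U"
  shows "partition_fun \<beta> (U ** diag_mat d ** adjoint_mat U) = (\<Sum>i\<in>UNIV. exp (- \<beta> * d i))"
  unfolding partition_fun_def matexp_scaleR_conj_diag[OF assms] trace_conj[OF assms] trace_diag_mat
  by simp

lemma gibbs_conj_diag:
  assumes "unitary U"
  shows "gibbs \<beta> (U ** diag_mat d ** adjoint_mat U)
    = U ** diag_mat (boltzmann \<beta> d) ** adjoint_mat U"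
  unfolding gibbs_def Let_def matexp_scaleR_conj_diag[OF assms] trace_conj[OF assms] trace_diag_mat
  by (simp add: vec_eq_iff conj_diag_nth boltzmann_def map_matrix_def sum_divide_distrib)

lemma hermitian_conj_diag: "hermitian (U ** diag_mat d ** adjoint_mat U)"
  by (simp add: hermitian_def adjoint_mat_mult matrix_mul_assoc)

lemma vn_entropy_conj_diag:
  assumes "unitary U"
  shows "vn_entropy (U ** diag_mat p ** adjoint_mat U) = - (\<Sum>i\<in>UNIV. p i * ln (p i))"
  unfolding vn_entropy_def matfun_eq[OF assms] conj_mult[OF assms] trace_conj[OF assms]
    diag_mat_mult trace_diag_mat
  by simp

lemma conj_diag_inj:
  assumes U: "unitary U" and eq: "U ** diag_mat p ** adjoint_mat U = U ** diag_mat q ** adjoint_mat U"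
  shows "p = q"
proof -
  have "adjoint_mat U ** (U ** diag_mat r ** adjoint_mat U) ** U = diag_mat r" for r
  proof -
    have "adjoint_mat U ** (U ** diag_mat r ** adjoint_mat U) ** U
        = (adjoint_mat U ** U) ** diag_mat r ** (adjoint_mat U ** U)"
      by (simp only: matrix_mul_assoc)
    then show ?thesis by (simp add: unitaryD[OF U])
  qed
  with eq have "diag_mat p = (diag_mat q :: 'a cmat)" by metis
  then have "diag_mat p $ i $ i = (diag_mat q :: 'a cmat) $ i $ i" for i by simp
  then show ?thesis by (simp add: diag_mat_def fun_eq_iff)
qed

text \<open>The squared moduli of the entries of \<open>W\<close> are the overlaps between the two
  eigenbases. They replace a common eigenbasis, as the two matrices need not commute.\<close>

lemma trace_two_conj_diag:
  fixes U V :: "'n::finite cmat"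
  defines "W \<equiv> adjoint_mat U ** V"
  shows "trace ((U ** diag_mat a ** adjoint_mat U) ** (V ** diag_mat b ** adjoint_mat V))
    = of_real (\<Sum>i\<in>UNIV. \<Sum>j\<in>UNIV. a i * (cmod (W $ i $ j))\<^sup>2 * b j)"
proof -
  have "trace ((U ** diag_mat a ** adjoint_mat U) ** (V ** diag_mat b ** adjoint_mat V))
      = trace (U ** (diag_mat a ** (adjoint_mat U ** V ** diag_mat b ** adjoint_mat V)))"
    by (simp only: matrix_mul_assoc)
  also have "\<dots> = trace (diag_mat a ** (adjoint_mat U ** V ** diag_mat b ** adjoint_mat V) ** U)"
    by (rule trace_mul_sym)
  also have "\<dots> = trace (diag_mat a ** (W ** diag_mat b ** adjoint_mat W))"
    by (simp add: W_def adjoint_mat_mult matrix_mul_assoc)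
  also have "\<dots> = of_real (\<Sum>i\<in>UNIV. \<Sum>j\<in>UNIV. a i * (cmod (W $ i $ j))\<^sup>2 * b j)"
    by (simp add: trace_def diag_mat_mult_nth conj_diag_nth sum_distrib_left complex_norm_square mult_ac
        del: of_real_power)
  finally show ?thesis .
qed

lemma unitary_doubly_stochastic:
  assumes "unitary U" "unitary V"
  defines "W \<equiv> adjoint_mat U ** V"
  shows "(\<Sum>i\<in>UNIV. (cmod (W $ i $ j))\<^sup>2) = 1" "(\<Sum>j\<in>UNIV. (cmod (W $ i $ j))\<^sup>2) = 1"
proof -
  have "adjoint_mat W ** W = adjoint_mat V ** (U ** adjoint_mat U) ** V"
    by (simp only: W_def adjoint_mat_mult adjoint_mat_adjoint matrix_mul_assoc)
  then have 1: "adjoint_mat W ** W = mat 1" by (simp add: unitaryD assms)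
  have "W ** adjoint_mat W = adjoint_mat U ** (V ** adjoint_mat V) ** U"
    by (simp only: W_def adjoint_mat_mult adjoint_mat_adjoint matrix_mul_assoc)
  then have 2: "W ** adjoint_mat W = mat 1" by (simp add: unitaryD assms)
  have "complex_of_real (\<Sum>i\<in>UNIV. (cmod (W $ i $ j))\<^sup>2) = (adjoint_mat W ** W) $ j $ j"
    by (simp add: matrix_matrix_mult_def complex_norm_square mult.commute del: of_real_power)
  also have "\<dots> = of_real 1" by (simp only: 1) (simp add: mat_def)
  finally show "(\<Sum>i\<in>UNIV. (cmod (W $ i $ j))\<^sup>2) = 1" by (simp only: of_real_eq_iff)
  have "complex_of_real (\<Sum>j\<in>UNIV. (cmod (W $ i $ j))\<^sup>2) = (W ** adjoint_mat W) $ i $ i"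
    by (simp add: matrix_matrix_mult_def complex_norm_square mult.commute del: of_real_power)
  also have "\<dots> = of_real 1" by (simp only: 2) (simp add: mat_def)
  finally show "(\<Sum>j\<in>UNIV. (cmod (W $ i $ j))\<^sup>2) = 1" by (simp only: of_real_eq_iff)
qed

lemma ln_boltzmann:
  "ln (boltzmann \<beta> d i) = - \<beta> * d i - ln (\<Sum>j\<in>UNIV. exp (- \<beta> * d j))"
proof -
  have "(\<Sum>j\<in>UNIV. exp (- \<beta> * d j)) > 0" by (simp add: sum_pos)
  then show ?thesis by (simp add: boltzmann_def ln_div)
qed

text \<open>Average \<open>ln_boltzmann\<close> over the Boltzmann weights, which sum to
  one.\<close>

lemma vn_entropy_gibbs:
  assumes "hermitian H"
  shows "vn_entropy (gibbs \<beta> H) = \<beta> * energy H (gibbs \<beta> H) + ln (partition_fun \<beta> H)"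
proof -
  obtain U d where U: "unitary U" and H: "H = U ** diag_mat d ** adjoint_mat U"
    using hermitian_diagonalization[OF assms] .
  let ?p = "boltzmann \<beta> d"
  have "energy H (gibbs \<beta> H) = (\<Sum>i\<in>UNIV. d i * ?p i)"
    unfolding H energy_def gibbs_conj_diag[OF U] conj_mult[OF U] trace_conj[OF U] diag_mat_mult trace_diag_mat
    by simp
  moreover have "vn_entropy (gibbs \<beta> H) = - (\<Sum>i\<in>UNIV. ?p i * ln (?p i))"
    unfolding H gibbs_conj_diag[OF U] vn_entropy_conj_diag[OF U] ..
  moreover have "- (\<Sum>i\<in>UNIV. ?p i * ln (?p i))
      = \<beta> * (\<Sum>i\<in>UNIV. d i * ?p i) + (\<Sum>i\<in>UNIV. ?p i) * ln (\<Sum>j\<in>UNIV. exp (- \<beta> * d j))"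
    by (simp add: ln_boltzmann algebra_simps sum.distrib sum_distrib_left sum_distrib_right
        sum_subtractf sum_negf)
  ultimately show ?thesis
    by (simp add: sum_boltzmann H partition_fun_conj_diag[OF U])
qed

text \<open>The difference of the two sides is the quantum relative entropy of
  \<open>gibbs b K\<close> with respect to \<open>gibbs \<beta> H\<close>. Expanded in the
  eigenbases of both, it is a sum of nonnegative terms \<open>t i j\<close>, all of which vanish
  only if the two states agree.\<close>

lemma gibbs_variational:
  fixes H K :: "'n::finite cmat"
  assumes "hermitian H" "hermitian K"
  shows "vn_entropy (gibbs b K) \<le> \<beta> * energy H (gibbs b K) + ln (partition_fun \<beta> H)" (is ?le)
    and "gibbs b K \<noteq> gibbs \<beta> H
      \<Longrightarrow> vn_entropy (gibbs b K) < \<beta> * energy H (gibbs b K) + ln (partition_fun \<beta> H)" (is "_ \<Longrightarrow> ?lt")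
proof -
  obtain U d where U: "unitary U" and H: "H = U ** diag_mat d ** adjoint_mat U"
    using hermitian_diagonalization[OF assms(1)] .
  obtain V e where V: "unitary V" and K: "K = V ** diag_mat e ** adjoint_mat V"
    using hermitian_diagonalization[OF assms(2)] .
  define p where "p = boltzmann b e"
  define q where "q = boltzmann \<beta> d"
  define W where "W = adjoint_mat U ** V"
  define B where "B i j = (cmod (W $ i $ j))\<^sup>2" for i j
  have B0: "0 \<le> B i j" for i j by (simp add: B_def)
  have p0: "p j > 0" and q0: "q j > 0" for j by (simp_all add: p_def q_def boltzmann_pos)
  have col: "(\<Sum>i\<in>UNIV. B i j) = 1" and row: "(\<Sum>j\<in>UNIV. B i j) = 1" for i j
    using unitary_doubly_stochastic[OF U V] by (simp_all add: B_def W_def)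
  have S: "vn_entropy (gibbs b K) = - (\<Sum>j\<in>UNIV. p j * ln (p j))"
    unfolding K gibbs_conj_diag[OF V] vn_entropy_conj_diag[OF V] p_def ..
  have E: "energy H (gibbs b K) = (\<Sum>i\<in>UNIV. \<Sum>j\<in>UNIV. d i * B i j * p j)"
    unfolding H K energy_def gibbs_conj_diag[OF V] trace_two_conj_diag by (simp add: B_def W_def p_def)
  have Z: "ln (partition_fun \<beta> H) = (\<Sum>i\<in>UNIV. \<Sum>j\<in>UNIV. B i j * p j * ln (\<Sum>j\<in>UNIV. exp (- \<beta> * d j)))"
  proof -
    have "(\<Sum>i\<in>UNIV. \<Sum>j\<in>UNIV. B i j * p j * c) = c" for c :: real
    proof -
      have "(\<Sum>i\<in>UNIV. \<Sum>j\<in>UNIV. B i j * p j * c) = (\<Sum>j\<in>UNIV. \<Sum>i\<in>UNIV. B i j * p j * c)"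
        by (rule sum.swap)
      also have "\<dots> = (\<Sum>j\<in>UNIV. (\<Sum>i\<in>UNIV. B i j) * p j * c)"
        by (simp add: sum_distrib_right)
      also have "\<dots> = c"
        by (simp add: col sum_distrib_right[symmetric] p_def sum_boltzmann)
      finally show ?thesis .
    qed
    then show ?thesis by (simp add: H partition_fun_conj_diag[OF U])
  qed
  have S': "vn_entropy (gibbs b K) = - (\<Sum>i\<in>UNIV. \<Sum>j\<in>UNIV. B i j * (p j * ln (p j)))"
  proof -
    have "(\<Sum>i\<in>UNIV. \<Sum>j\<in>UNIV. B i j * (p j * ln (p j))) = (\<Sum>j\<in>UNIV. \<Sum>i\<in>UNIV. B i j * (p j * ln (p j)))"
      by (rule sum.swap)
    also have "\<dots> = (\<Sum>j\<in>UNIV. p j * ln (p j))"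
      by (simp add: sum_distrib_right[symmetric] col)
    finally show ?thesis by (simp add: S)
  qed
  \<comment> \<open>This vanishing sum is added to the gap so that every single term becomes
    nonnegative.\<close>
  have total: "(\<Sum>i\<in>UNIV. \<Sum>j\<in>UNIV. B i j * (q i - p j)) = 0"
  proof -
    have "(\<Sum>i\<in>UNIV. \<Sum>j\<in>UNIV. B i j * (q i - p j))
        = (\<Sum>i\<in>UNIV. \<Sum>j\<in>UNIV. B i j * q i) - (\<Sum>i\<in>UNIV. \<Sum>j\<in>UNIV. B i j * p j)"
      by (simp add: algebra_simps sum_subtractf)
    also have "(\<Sum>i\<in>UNIV. \<Sum>j\<in>UNIV. B i j * p j) = (\<Sum>j\<in>UNIV. \<Sum>i\<in>UNIV. B i j * p j)"
      by (rule sum.swap)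
    also have "(\<Sum>i\<in>UNIV. \<Sum>j\<in>UNIV. B i j * q i) - (\<Sum>j\<in>UNIV. \<Sum>i\<in>UNIV. B i j * p j) = 0"
      by (simp add: sum_distrib_right[symmetric] col row p_def q_def sum_boltzmann)
    finally show ?thesis .
  qed
  \<comment> \<open>Jensen's inequality for the doubly stochastic \<open>B\<close>, termwise via \<open>ln x \<le> x - 1\<close>.\<close>
  define t where "t i j = B i j * (q i - p j) - B i j * (p j * (ln (q i) - ln (p j)))" for i j
  have gap: "\<beta> * energy H (gibbs b K) + ln (partition_fun \<beta> H) - vn_entropy (gibbs b K)
      = (\<Sum>i\<in>UNIV. \<Sum>j\<in>UNIV. t i j)"
  proof -
    have "t i j = B i j * (q i - p j) + (\<beta> * (d i * B i j * p j)
        + B i j * p j * ln (\<Sum>j\<in>UNIV. exp (- \<beta> * d j)) + B i j * (p j * ln (p j)))" for i j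
      by (simp add: t_def q_def ln_boltzmann algebra_simps)
    then show ?thesis
      unfolding S' E Z by (simp add: sum.distrib total sum_distrib_left)
  qed
  have ln_ineq: "p j * (ln (q i) - ln (p j)) \<le> q i - p j" for i j
  proof -
    have "ln (q i / p j) \<le> q i / p j - 1"
      using p0 q0 by (intro ln_le_minus_one divide_pos_pos)
    then have "p j * ln (q i / p j) \<le> p j * (q i / p j - 1)"
      using p0 by (intro mult_left_mono) (auto intro: less_imp_le)
    then show ?thesis
      using p0[of j] q0[of i] by (simp add: ln_div right_diff_distrib)
  qed
  have t0: "0 \<le> t i j" for i j
    using mult_left_mono[OF ln_ineq[of j i] B0[of i j]] by (simp add: t_def)
  have "0 \<le> (\<Sum>i\<in>UNIV. \<Sum>j\<in>UNIV. t i j)"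
    by (intro sum_nonneg t0)
  then show ?le using gap by simp
  assume ne: "gibbs b K \<noteq> gibbs \<beta> H"
  \<comment> \<open>If nonzero overlaps only join equal eigenvalues, then \<open>W\<close>
    intertwines the two diagonal matrices and the states coincide.\<close>
  have "\<exists>i j. W $ i $ j \<noteq> 0 \<and> q i \<noteq> p j"
  proof (rule ccontr)
    assume "\<not> ?thesis"
    then have eq: "W $ i $ j = 0 \<or> q i = p j" for i j
      by blast
    have "W $ i $ j * complex_of_real (p j) = complex_of_real (q i) * W $ i $ j" for i j
      using eq[of i j] by auto
    then have "W ** diag_mat p = diag_mat q ** W"
      by (simp add: vec_eq_iff diag_mat_mult_nth)
    then have "U ** (W ** diag_mat p) ** adjoint_mat V = U ** (diag_mat q ** W) ** adjoint_mat V"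
      by simp
    moreover have "U ** (W ** diag_mat p) ** adjoint_mat V = U ** adjoint_mat U ** V ** diag_mat p ** adjoint_mat V"
      by (simp only: W_def matrix_mul_assoc)
    moreover have "U ** (diag_mat q ** W) ** adjoint_mat V
        = U ** diag_mat q ** adjoint_mat U ** (V ** adjoint_mat V)"
      by (simp only: W_def matrix_mul_assoc)
    ultimately have "V ** diag_mat p ** adjoint_mat V = U ** diag_mat q ** adjoint_mat U"
      by (simp add: unitaryD[OF U] unitaryD[OF V])
    with ne show False
      by (simp add: H K gibbs_conj_diag[OF U] gibbs_conj_diag[OF V] p_def q_def)
  qed
  then obtain i j where ij: "W $ i $ j \<noteq> 0" "q i \<noteq> p j" by blast
  have "ln (q i / p j) < q i / p j - 1"
    using ij p0[of j] q0[of i] ln_eq_minus_one[of "q i / p j"] ln_le_minus_one[of "q i / p j"]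
    by (force simp: less_le)
  then have "p j * ln (q i / p j) < p j * (q i / p j - 1)"
    using p0 by (intro mult_strict_left_mono)
  then have "p j * (ln (q i) - ln (p j)) < q i - p j"
    using p0[of j] q0[of i] by (simp add: ln_div right_diff_distrib)
  then have "0 < t i j"
    using mult_strict_left_mono[of _ _ "B i j"] ij by (fastforce simp: t_def B_def)
  also have "\<dots> \<le> (\<Sum>j\<in>UNIV. t i j)"
    using t0 by (intro member_le_sum) auto
  also have "\<dots> \<le> (\<Sum>i\<in>UNIV. \<Sum>j\<in>UNIV. t i j)"
    using t0 by (intro member_le_sum[where f = "\<lambda>i. \<Sum>j\<in>UNIV. t i j"]) (auto intro: sum_nonneg)
  finally show ?lt using gap by simp
qed

section \<open>Monotonicity and continuity in the inverse temperature\<close>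

text \<open>The variational inequality with \<open>ln (partition_fun \<beta> H)\<close> eliminated
  by \<open>vn_entropy_gibbs\<close>. At equal energies it is the maximum entropy principle; with
  \<open>K = H\<close> it compares two temperatures.\<close>

lemma gibbs_inequality:
  assumes "hermitian H" "hermitian K"
  shows "vn_entropy (gibbs b K)
    \<le> vn_entropy (gibbs \<beta> H) + \<beta> * (energy H (gibbs b K) - energy H (gibbs \<beta> H))"
    and "gibbs b K \<noteq> gibbs \<beta> H \<Longrightarrow> vn_entropy (gibbs b K)
    < vn_entropy (gibbs \<beta> H) + \<beta> * (energy H (gibbs b K) - energy H (gibbs \<beta> H))"
  using gibbs_variational[OF assms, of b \<beta>]
  by (simp_all add: vn_entropy_gibbs[OF assms(1)] right_diff_distrib)

text \<open>The hypothesis covers both infinite temperature, \<open>\<beta> = 0\<close>, and scalar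
  Hamiltonians, where \<open>d\<close> is constant.\<close>

lemma gibbs_const_diag:
  fixes U :: "'n::finite cmat"
  assumes U: "unitary U" and c: "\<And>i. \<beta> * d i = c"
  shows "gibbs \<beta> (U ** diag_mat d ** adjoint_mat U) = (1 / CARD('n)) *\<^sub>R mat 1"
proof -
  have "boltzmann \<beta> d = (\<lambda>i. 1 / CARD('n) * 1)"
    by (simp add: boltzmann_def c fun_eq_iff)
  then show ?thesis
    unfolding gibbs_conj_diag[OF U]
    by (simp only: scaleR_conj_diag[symmetric]) (simp add: unitaryD[OF U] diag_mat_one)
qed

lemma unitary_mat_1: "unitary (mat 1)"
proof -
  have "adjoint_mat (mat 1) = (mat 1 :: 'a cmat)"
    by (simp add: vec_eq_iff mat_def)
  then show ?thesis by (simp add: unitary_def)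
qed

lemma diag_mat_const: "diag_mat (\<lambda>i. r) = r *\<^sub>R (mat 1 :: 'n::finite cmat)"
  using scaleR_diag_mat[of r "\<lambda>i :: 'n. 1"] by (simp add: diag_mat_one)

lemma scalar_conj_diag:
  assumes "unitary U"
  shows "U ** diag_mat (\<lambda>i. r) ** adjoint_mat U = r *\<^sub>R mat 1"
  by (simp add: diag_mat_const matrix_mult_scaleR matrix_scaleR_mult unitaryD[OF assms])

lemma gibbs_scalar: "gibbs \<beta> (r *\<^sub>R mat 1) = (1 / CARD('n)) *\<^sub>R (mat 1 :: 'n::finite cmat)"
proof -
  have "gibbs \<beta> (mat 1 ** diag_mat (\<lambda>i. r) ** adjoint_mat (mat 1 :: 'n cmat)) = (1 / CARD('n)) *\<^sub>R mat 1"
    by (rule gibbs_const_diag[OF unitary_mat_1 refl])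
  then show ?thesis by (simp only: scalar_conj_diag[OF unitary_mat_1])
qed

lemma gibbs_0:
  fixes H :: "'n::finite cmat"
  assumes "hermitian H"
  shows "gibbs 0 H = (1 / CARD('n)) *\<^sub>R mat 1"
proof -
  obtain U d where "unitary U" "H = U ** diag_mat d ** adjoint_mat U"
    using hermitian_diagonalization[OF assms] .
  then show ?thesis by (simp add: gibbs_const_diag)
qed

lemma vn_entropy_maximally_mixed:
  "vn_entropy ((1 / CARD('n)) *\<^sub>R (mat 1 :: 'n::finite cmat)) = ln CARD('n)"
proof -
  have "(1 / CARD('n)) *\<^sub>R mat 1 = mat 1 ** diag_mat (\<lambda>i. 1 / CARD('n)) ** adjoint_mat (mat 1 :: 'n cmat)"
    by (rule scalar_conj_diag[OF unitary_mat_1, symmetric])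
  then show ?thesis
    by (simp only: vn_entropy_conj_diag[OF unitary_mat_1]) (simp add: ln_div)
qed

lemma vn_entropy_gibbs_0:
  fixes H :: "'n::finite cmat"
  assumes "hermitian H"
  shows "vn_entropy (gibbs 0 H) = ln CARD('n)"
  by (simp only: gibbs_0[OF assms] vn_entropy_maximally_mixed)

lemma vn_entropy_gibbs_le:
  fixes H :: "'n::finite cmat"
  assumes "hermitian H"
  shows "vn_entropy (gibbs \<beta> H) \<le> ln CARD('n)"
  using gibbs_inequality(1)[OF assms assms, of \<beta> 0] vn_entropy_gibbs_0[OF assms] by simp

lemma gibbs_eq_imp_scalar:
  assumes "hermitian H" and eq: "gibbs b H = gibbs c H" and ne: "b \<noteq> c"
  obtains r where "H = r *\<^sub>R mat 1"
proof -
  obtain U d where U: "unitary U" and H: "H = U ** diag_mat d ** adjoint_mat U"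
    using hermitian_diagonalization[OF assms(1)] .
  have bc: "boltzmann b d = boltzmann c d"
    using eq unfolding H gibbs_conj_diag[OF U] by (rule conj_diag_inj[OF U])
  have "d i = d j" for i j
  proof -
    \<comment> \<open>Differences of logarithms eliminate the partition functions.\<close>
    have "ln (boltzmann b d i) - ln (boltzmann b d j) = ln (boltzmann c d i) - ln (boltzmann c d j)"
      by (simp add: bc)
    then have "(b - c) * (d i - d j) = 0"
      by (simp add: ln_boltzmann algebra_simps)
    then show ?thesis using ne by simp
  qed
  then have "d = (\<lambda>i. d undefined)" by blast
  then show ?thesis using H scalar_conj_diag[OF U] that by metis
qed

text \<open>Used in contrapositive form: a single entropy value below \<open>ln CARD('n)\<close>
  certifies that different inverse temperatures give different states.\<close>

lemma gibbs_eq_imp_max_entropy: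
  fixes H :: "'n::finite cmat"
  assumes "hermitian H" "gibbs b H = gibbs c H" "b \<noteq> c"
  shows "vn_entropy (gibbs x H) = ln CARD('n)"
  using gibbs_eq_imp_scalar[OF assms] by (metis gibbs_scalar vn_entropy_maximally_mixed)

text \<open>Equality in the Gibbs inequality against infinite temperature forces
  \<open>gibbs b H = gibbs 0 H\<close>.\<close>

lemma max_entropy_imp_scalar:
  fixes H :: "'n::finite cmat"
  assumes H: "hermitian H" and "b \<noteq> 0" and "vn_entropy (gibbs b H) = ln CARD('n)"
  obtains r where "H = r *\<^sub>R mat 1"
proof -
  have "gibbs b H = gibbs 0 H"
    using gibbs_inequality(2)[OF H H, of b 0] assms(3) vn_entropy_gibbs_0[OF H] by force
  then show ?thesis using gibbs_eq_imp_scalar[OF H _ \<open>b \<noteq> 0\<close>] that by metis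
qed

text \<open>Adding the strict Gibbs inequalities for the two states in both orders cancels the
  entropies.\<close>

lemma energy_gibbs_strict_decreasing:
  fixes H :: "'n::finite cmat"
  assumes H: "hermitian H" and x: "vn_entropy (gibbs x H) < ln CARD('n)" and bc: "b < c"
  shows "energy H (gibbs c H) < energy H (gibbs b H)"
proof -
  have "gibbs b H \<noteq> gibbs c H"
    using gibbs_eq_imp_max_entropy[OF H, of b c x] x bc by auto
  from gibbs_inequality(2)[OF H H this] gibbs_inequality(2)[OF H H this[symmetric]]
  have "0 < (c - b) * (energy H (gibbs b H) - energy H (gibbs c H))"
    by (simp add: algebra_simps)
  then show ?thesis using bc by (simp add: zero_less_mult_iff)
qed

text \<open>By the Gibbs inequality the entropy change from \<open>b\<close> to \<open>c\<close> is
  less than \<open>b\<close> times the energy change, which is nonpositive for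
  \<open>b \<ge> 0\<close>.\<close>

lemma vn_entropy_gibbs_strict_decreasing:
  fixes H :: "'n::finite cmat"
  assumes H: "hermitian H" and x: "vn_entropy (gibbs x H) < ln CARD('n)" and bc: "0 \<le> b" "b < c"
  shows "vn_entropy (gibbs c H) < vn_entropy (gibbs b H)"
proof -
  have "gibbs c H \<noteq> gibbs b H"
    using gibbs_eq_imp_max_entropy[OF H, of b c x] x bc by auto
  from gibbs_inequality(2)[OF H H this]
  have "vn_entropy (gibbs c H) < vn_entropy (gibbs b H) + b * (energy H (gibbs c H) - energy H (gibbs b H))" .
  moreover have "b * (energy H (gibbs c H) - energy H (gibbs b H)) \<le> 0"
    using energy_gibbs_strict_decreasing[OF H x bc(2)] bc(1) by (simp add: mult_nonneg_nonpos)
  ultimately show ?thesis by linarith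
qed

text \<open>Reduces the complex trace condition in \<open>equilibrium_beta\<close> to an equation
  between real energies, to which the intermediate value theorem applies.\<close>

lemma trace_mult_gibbs:
  assumes "hermitian H" "hermitian K"
  shows "trace (H ** gibbs b K) = of_real (energy H (gibbs b K))"
proof -
  obtain U d where U: "unitary U" and H: "H = U ** diag_mat d ** adjoint_mat U"
    using hermitian_diagonalization[OF assms(1)] .
  obtain V e where V: "unitary V" and K: "K = V ** diag_mat e ** adjoint_mat V"
    using hermitian_diagonalization[OF assms(2)] .
  show ?thesis
    unfolding energy_def H K gibbs_conj_diag[OF V] trace_two_conj_diag by simp
qed

lemma equilibrium_beta_gibbs:
  assumes "hermitian H" "hermitian K"
  shows "equilibrium_beta (gibbs b K) H \<beta>
    \<longleftrightarrow> 0 < \<beta> \<and> energy H (gibbs \<beta> H) = energy H (gibbs b K)"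
  by (simp add: equilibrium_beta_def trace_mult_gibbs assms)

section \<open>Joint continuity of Gibbs states, energies and entropies\<close>

lemma bounded_bilinear_matrix_mult:
  "bounded_bilinear (\<lambda>(A :: 'n::finite cmat) (B :: 'n cmat). A ** B)"
proof -
  have "bilinear (\<lambda>(A :: 'n cmat) (B :: 'n cmat). A ** B)"
    unfolding bilinear_def
    by (auto intro!: linearI simp: matrix_scaleR_mult matrix_mult_scaleR)
      (simp_all add: matrix_matrix_mult_def vec_eq_iff sum.distrib distrib_right distrib_left)
  then show ?thesis
    by (simp add: bilinear_conv_bounded_bilinear)
qed

lemma bounded_bilinear_energy: "bounded_bilinear (energy :: 'n::finite cmat \<Rightarrow> 'n cmat \<Rightarrow> real)"
proof -
  have "bilinear (energy :: 'n cmat \<Rightarrow> 'n cmat \<Rightarrow> real)"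
    unfolding bilinear_def energy_def
    by (auto intro!: linearI
        simp: trace_def matrix_matrix_mult_def sum.distrib algebra_simps sum_distrib_left sum_subtractf)
  then show ?thesis
    by (simp add: bilinear_conv_bounded_bilinear)
qed

lemmas continuous_on_energy [continuous_intros] =
  bounded_bilinear.continuous_on[OF bounded_bilinear_energy]

text \<open>By the Weierstrass test the exponential series converges uniformly on every ball around
  \<open>0\<close>, and these balls exhaust the space.\<close>

lemma continuous_on_matexp: "continuous_on UNIV (matexp :: 'n::finite cmat \<Rightarrow> 'n cmat)"
proof -
  obtain K where K: "K > 0" "\<And>(A :: 'n cmat) (B :: 'n cmat). norm (A ** B) \<le> norm A * norm B * K"
    using bounded_bilinear.pos_bounded[OF bounded_bilinear_matrix_mult] by blast
  have pow: "norm (matpow A k) \<le> (R * K) ^ k * norm (mat 1 :: 'n cmat)" if "norm A \<le> R" for k R and A :: "'n cmat"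
  proof (induction k)
    case (Suc k)
    have "norm (matpow A (Suc k)) \<le> norm A * norm (matpow A k) * K"
      using K(2) by simp
    also have "\<dots> \<le> R * ((R * K) ^ k * norm (mat 1 :: 'n cmat)) * K"
      using Suc K(1) that by (intro mult_right_mono mult_mono) (auto intro: order_trans[OF norm_ge_zero])
    finally show ?case by (simp add: mult_ac)
  qed simp
  have powc: "continuous_on S (\<lambda>A. matpow A k)" for S :: "'n cmat set" and k
    by (induction k) (auto intro!: bounded_bilinear.continuous_on[OF bounded_bilinear_matrix_mult] continuous_intros)
  have cb: "continuous_on (cball 0 R) (matexp :: 'n cmat \<Rightarrow> _)" for R
  proof -
    have "uniform_limit (cball 0 R) (\<lambda>n A. \<Sum>k<n. (1 / fact k) *\<^sub>R matpow A k)
        (\<lambda>A :: 'n cmat. \<Sum>k. (1 / fact k) *\<^sub>R matpow A k) sequentially"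
    proof (rule Weierstrass_m_test)
      show "summable (\<lambda>k. inverse (fact k) * (R * K) ^ k * norm (mat 1 :: 'n cmat))"
        by (intro summable_mult2 summable_exp)
      show "norm ((1 / fact k) *\<^sub>R matpow A k) \<le> inverse (fact k) * (R * K) ^ k * norm (mat 1 :: 'n cmat)"
        if "A \<in> cball 0 R" for k and A :: "'n cmat"
        using mult_left_mono[OF pow[of A R k], of "inverse (fact k)"] that
        by (simp add: divide_inverse mult_ac)
    qed
    then have "uniform_limit (cball 0 R) (\<lambda>n A. \<Sum>k<n. (1 / fact k) *\<^sub>R matpow A k)
        (matexp :: 'n cmat \<Rightarrow> _) sequentially"
      by (simp add: matexp_def[abs_def])
    then show ?thesis
      by (rule uniform_limit_theorem[rotated]) (auto intro!: always_eventually continuous_intros powc)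
  qed
  have "isCont matexp A" for A :: "'n cmat"
  proof -
    have "continuous_on (ball 0 (norm A + 1)) (matexp :: 'n cmat \<Rightarrow> _)"
      by (rule continuous_on_subset[OF cb ball_subset_cball])
    then show ?thesis
      by (simp add: continuous_on_eq_continuous_at)
  qed
  then show ?thesis by (simp add: continuous_on_eq_continuous_at)
qed

lemma partition_fun_pos:
  assumes "hermitian H"
  shows "0 < partition_fun \<beta> H" "trace (matexp ((- \<beta>) *\<^sub>R H)) \<noteq> 0"
proof -
  obtain U d where U: "unitary U" and H: "H = U ** diag_mat d ** adjoint_mat U"
    using hermitian_diagonalization[OF assms] .
  show "0 < partition_fun \<beta> H"
    unfolding H partition_fun_conj_diag[OF U] by (simp add: sum_pos)
  then show "trace (matexp ((- \<beta>) *\<^sub>R H)) \<noteq> 0"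
    by (auto simp: partition_fun_def)
qed

lemma continuous_on_gibbs:
  fixes H :: "'a::topological_space \<Rightarrow> 'n::finite cmat"
  assumes "continuous_on S b" "continuous_on S H" "\<And>x. x \<in> S \<Longrightarrow> hermitian (H x)"
  shows "continuous_on S (\<lambda>x. gibbs (b x) (H x))"
proof -
  have E: "continuous_on S (\<lambda>x. matexp ((- b x) *\<^sub>R H x))"
    by (rule continuous_on_compose2[OF continuous_on_matexp])
      (auto intro!: continuous_intros assms)
  show ?thesis
    unfolding gibbs_def Let_def map_matrix_def trace_def
    using partition_fun_pos(2)[OF assms(3)]
    by (intro continuous_intros E) (simp add: trace_def)
qed

text \<open>Continuity is read off from the closed form \<open>vn_entropy_gibbs\<close> rather than
  from the spectral definition by \<open>matfun\<close>.\<close>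

lemma continuous_on_vn_entropy_gibbs:
  fixes H :: "'a::topological_space \<Rightarrow> 'n::finite cmat"
  assumes "continuous_on S b" "continuous_on S H" "\<And>x. x \<in> S \<Longrightarrow> hermitian (H x)"
  shows "continuous_on S (\<lambda>x. vn_entropy (gibbs (b x) (H x)))"
proof -
  have E: "continuous_on S (\<lambda>x. matexp ((- b x) *\<^sub>R H x))"
    by (rule continuous_on_compose2[OF continuous_on_matexp])
      (auto intro!: continuous_intros assms)
  have "continuous_on S (\<lambda>x. partition_fun (b x) (H x))"
    unfolding partition_fun_def trace_def by (intro continuous_intros E)
  moreover have "partition_fun (b x) (H x) \<noteq> 0" if "x \<in> S" for x
    using partition_fun_pos(1)[OF assms(3)[OF that], of "b x"] by simp
  ultimately have "continuous_on S (\<lambda>x. b x * energy (H x) (gibbs (b x) (H x)) + ln (partition_fun (b x) (H x)))"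
    by (intro continuous_intros continuous_on_gibbs assms) auto
  then show ?thesis
    by (rule continuous_on_eq) (simp add: vn_entropy_gibbs assms(3))
qed

section \<open>Quasi-static processes along paths admitting isentropic Gibbs states\<close>

text \<open>At each \<open>u\<close>, \<open>low_entropy\<close> and \<open>s_less\<close> bracket
  \<open>s\<close> between the entropies at some finite and at infinite temperature, which yields an
  isentropic inverse temperature. The Lipschitz bound makes the entropy production of one step small
  compared with its length.\<close>

locale entropy_path =
  fixes H :: "real \<Rightarrow> 'n::finite cmat" and s L \<beta>0 :: real
  assumes hermitian_path: "\<And>u. u \<in> {0..1} \<Longrightarrow> hermitian (H u)"
    and lipschitz: "L-lipschitz_on {0..1} H"
    and low_entropy: "\<And>u. u \<in> {0..1} \<Longrightarrow> \<exists>\<beta>>0. vn_entropy (gibbs \<beta> (H u)) < s"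
    and s_less: "s < ln CARD('n)"
    and \<beta>0_pos: "0 < \<beta>0"
    and start: "vn_entropy (gibbs \<beta>0 (H 0)) = s"
begin

definition ent :: "real \<Rightarrow> real \<Rightarrow> real"
  where "ent b u = vn_entropy (gibbs b (H u))"

lemma continuous_on_path:
  assumes "continuous_on S v" "v ` S \<subseteq> {0..1}"
  shows "continuous_on S (\<lambda>x. H (v x))"
  using continuous_on_compose2[OF lipschitz_on_continuous_on[OF lipschitz] assms] .

lemma continuous_on_gibbs_path:
  assumes "continuous_on S b" "continuous_on S v" "v ` S \<subseteq> {0..1}"
  shows "continuous_on S (\<lambda>x. gibbs (b x) (H (v x)))"
  using assms by (intro continuous_on_gibbs continuous_on_path hermitian_path) auto

lemma continuous_on_ent: "continuous_on (UNIV \<times> {0..1}) (\<lambda>x. ent (fst x) (snd x))"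
  unfolding ent_def
  by (intro continuous_on_vn_entropy_gibbs continuous_on_path hermitian_path continuous_intros) auto

lemma tendsto_ent:
  assumes "(b \<longlongrightarrow> b') F" "(v \<longlongrightarrow> v') F" "v' \<in> {0..1}" "\<forall>\<^sub>F x in F. v x \<in> {0..1}"
  shows "((\<lambda>x. ent (b x) (v x)) \<longlongrightarrow> ent b' v') F"
  using continuous_on_tendsto_compose[OF continuous_on_ent tendsto_Pair[OF assms(1,2)]] assms(3,4)
  by simp

lemma not_max_entropy:
  assumes "u \<in> {0..1}"
  obtains x where "vn_entropy (gibbs x (H u)) < ln CARD('n)"
  using low_entropy[OF assms] s_less by (meson less_trans)

lemma ent_strict_decreasing: "u \<in> {0..1} \<Longrightarrow> 0 \<le> b \<Longrightarrow> b < c \<Longrightarrow> ent c u < ent b u"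
  unfolding ent_def
  using vn_entropy_gibbs_strict_decreasing[OF hermitian_path] not_max_entropy by metis

lemma energy_strict_decreasing:
  "u \<in> {0..1} \<Longrightarrow> b < c \<Longrightarrow> energy (H u) (gibbs c (H u)) < energy (H u) (gibbs b (H u))"
  using energy_gibbs_strict_decreasing[OF hermitian_path] not_max_entropy by metis

lemma ent_0: "u \<in> {0..1} \<Longrightarrow> ent 0 u = ln CARD('n)"
  by (simp add: ent_def vn_entropy_gibbs_0 hermitian_path)

text \<open>Otherwise there are counterexamples at inverse temperatures tending to infinity, whose
  parameters accumulate at some \<open>l\<close>. An inverse temperature that works at
  \<open>l\<close> works nearby by continuity, and by monotonicity so do all larger ones.\<close>

lemma uniform_low_entropy:
  obtains B where "0 < B" "\<And>u. u \<in> {0..1} \<Longrightarrow> ent B u < s"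
proof -
  have "\<exists>k::nat. \<forall>u\<in>{0..1}. ent (real (Suc k)) u < s"
  proof (rule ccontr)
    assume "\<not> ?thesis"
    then obtain v where v: "\<And>k::nat. v k \<in> {0..1}" "\<And>k. s \<le> ent (real (Suc k)) (v k)"
      by (metis not_less)
    obtain l r where l: "l \<in> {0..1::real}" and r: "strict_mono r" and lim: "(v \<circ> r) \<longlonglongrightarrow> l"
      using v(1) compact_Icc[of 0 "1::real"] unfolding compact_def by metis
    obtain \<beta> where \<beta>: "0 < \<beta>" "ent \<beta> l < s"
      using low_entropy[OF l] by (auto simp: ent_def)
    have "(\<lambda>k. ent \<beta> ((v \<circ> r) k)) \<longlonglongrightarrow> ent \<beta> l"
      using v(1) by (intro tendsto_ent lim l tendsto_const) simp
    then have "\<forall>\<^sub>F k in sequentially. ent \<beta> ((v \<circ> r) k) < s"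
      using \<beta>(2) by (rule order_tendstoD)
    moreover have "\<forall>\<^sub>F k in sequentially. \<beta> < real k"
      using filterlim_real_sequentially by (simp add: filterlim_at_top_dense)
    ultimately have "\<forall>\<^sub>F k in sequentially. False"
    proof eventually_elim
      case (elim k)
      have "real k \<le> real (r k)" using seq_suble[OF r] by simp
      then have "ent (real (Suc (r k))) (v (r k)) < ent \<beta> (v (r k))"
        using elim \<beta>(1) v(1) by (intro ent_strict_decreasing) auto
      then show ?case using v(2)[of "r k"] elim by simp
    qed
    then show False by simp
  qed
  then show ?thesis using that by (metis of_nat_0_less_iff zero_less_Suc)
qed

text \<open>The same compactness argument at inverse temperature \<open>0\<close>, where the entropy
  is \<open>ln CARD('n)\<close> for every \<open>u\<close>.\<close>

lemma uniform_high_entropy: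
  assumes "t < ln CARD('n)"
  obtains \<epsilon> where "0 < \<epsilon>" "\<And>u. u \<in> {0..1} \<Longrightarrow> t < ent \<epsilon> u"
proof -
  have "\<exists>k::nat. \<forall>u\<in>{0..1}. t < ent (1 / real (Suc k)) u"
  proof (rule ccontr)
    assume "\<not> ?thesis"
    then obtain v where v: "\<And>k::nat. v k \<in> {0..1}" "\<And>k. ent (1 / real (Suc k)) (v k) \<le> t"
      by (metis not_less)
    obtain l r where l: "l \<in> {0..1::real}" and r: "strict_mono r" and lim: "(v \<circ> r) \<longlonglongrightarrow> l"
      using v(1) compact_Icc[of 0 "1::real"] unfolding compact_def by metis
    have "(\<lambda>k. 1 / real (Suc (r k))) \<longlonglongrightarrow> 0"
      using LIMSEQ_subseq_LIMSEQ[OF LIMSEQ_inverse_real_of_nat r] by (simp add: o_def inverse_eq_divide)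
    then have "(\<lambda>k. ent (1 / real (Suc (r k))) ((v \<circ> r) k)) \<longlonglongrightarrow> ent 0 l"
      using v(1) by (intro tendsto_ent lim l) simp_all
    then have "ent 0 l \<le> t"
      using v(2) by (intro LIMSEQ_le_const2) (auto simp del: of_nat_Suc)
    then show False using assms ent_0[OF l] by simp
  qed
  then obtain k where "\<forall>u\<in>{0..1}. t < ent (1 / real (Suc k)) u" by blast
  then show ?thesis by (intro that[of "1 / real (Suc k)"]) auto
qed

text \<open>On the diagonal \<open>u = v\<close> this is the strict decrease of the energy from
  inverse temperature \<open>0\<close> to \<open>b \<ge> \<epsilon>\<close>; compactness extends it
  to nearby \<open>u\<close> and \<open>v\<close>. After a short quench the energy is thus still
  below that at infinite temperature, which keeps the new inverse temperature positive.\<close>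

lemma uniform_energy_gap:
  assumes "0 < \<epsilon>"
  obtains \<delta> where "0 < \<delta>" "\<And>u v b. u \<in> {0..1} \<Longrightarrow> v \<in> {0..1} \<Longrightarrow> \<bar>u - v\<bar> < \<delta> \<Longrightarrow> b \<in> {\<epsilon>..B}
    \<Longrightarrow> energy (H v) (gibbs b (H u)) < energy (H v) (gibbs 0 (H v))"
proof -
  have "\<exists>k::nat. \<forall>u\<in>{0..1}. \<forall>v\<in>{0..1}. \<forall>b\<in>{\<epsilon>..B}. \<bar>u - v\<bar> < 1 / real (Suc k)
    \<longrightarrow> energy (H v) (gibbs b (H u)) < energy (H v) (gibbs 0 (H v))"
  proof (rule ccontr)
    assume "\<not> ?thesis"
    then have "\<forall>k::nat. \<exists>x. x \<in> {0..1} \<times> {0..1} \<times> {\<epsilon>..B} \<and> \<bar>fst x - fst (snd x)\<bar> < 1 / real (Suc k)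
      \<and> energy (H (fst (snd x))) (gibbs 0 (H (fst (snd x))))
        \<le> energy (H (fst (snd x))) (gibbs (snd (snd x)) (H (fst x)))"
      by (fastforce simp: not_less)
    then obtain x where x: "\<And>k::nat. x k \<in> {0..1} \<times> {0..1} \<times> {\<epsilon>..B}"
      and close: "\<And>k. \<bar>fst (x k) - fst (snd (x k))\<bar> < 1 / real (Suc k)"
      and le: "\<And>k. energy (H (fst (snd (x k)))) (gibbs 0 (H (fst (snd (x k)))))
        \<le> energy (H (fst (snd (x k)))) (gibbs (snd (snd (x k))) (H (fst (x k))))"
      by metis
    define K where "K = ({0..1} \<times> {0..1} \<times> {\<epsilon>..B} :: (real \<times> real \<times> real) set)"
    have "compact K" by (simp add: K_def compact_Times)
    then obtain l r where l: "l \<in> K" and r: "strict_mono r" and lim: "(x \<circ> r) \<longlonglongrightarrow> l"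
      using x unfolding compact_def K_def by metis
    have "(\<lambda>k. 1 / real (Suc (r k))) \<longlonglongrightarrow> 0"
      using LIMSEQ_subseq_LIMSEQ[OF LIMSEQ_inverse_real_of_nat r] by (simp add: o_def inverse_eq_divide)
    then have "(\<lambda>k. fst (x (r k)) - fst (snd (x (r k)))) \<longlonglongrightarrow> 0"
      by (rule Lim_null_comparison[rotated]) (use close in \<open>auto intro!: always_eventually less_imp_le\<close>)
    moreover have "(\<lambda>k. fst (x (r k)) - fst (snd (x (r k)))) \<longlonglongrightarrow> fst l - fst (snd l)"
      using lim by (auto intro!: tendsto_intros simp: o_def)
    ultimately have diag: "fst l = fst (snd l)"
      using LIMSEQ_unique by force
    define g where "g z = energy (H (fst (snd z))) (gibbs (snd (snd z)) (H (fst z)))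
        - energy (H (fst (snd z))) (gibbs 0 (H (fst (snd z))))" for z
    have "continuous_on K g"
      unfolding g_def K_def
      by (intro continuous_intros continuous_on_path continuous_on_gibbs_path) auto
    then have "(\<lambda>k. g ((x \<circ> r) k)) \<longlonglongrightarrow> g l"
    proof (rule continuous_on_tendsto_compose[OF _ lim l])
      show "\<forall>\<^sub>F k in sequentially. (x \<circ> r) k \<in> K"
        using x by (simp add: K_def)
    qed
    then have "0 \<le> g l"
      using le by (intro LIMSEQ_le_const) (auto simp: g_def)
    moreover have "g l < 0"
      using energy_strict_decreasing[of "fst l" 0 "snd (snd l)"] l assms diag by (auto simp: g_def K_def)
    ultimately show False by simp
  qed
  then obtain k :: nat where "\<forall>u\<in>{0..1}. \<forall>v\<in>{0..1}. \<forall>b\<in>{\<epsilon>..B}. \<bar>u - v\<bar> < 1 / real (Suc k)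
    \<longrightarrow> energy (H v) (gibbs b (H u)) < energy (H v) (gibbs 0 (H v))" by blast
  then show ?thesis by (intro that[of "1 / real (Suc k)"]) auto
qed

text \<open>The energy term is bounded by a product of two norms: the Lipschitz property gives a
  factor proportional to \<open>\<bar>u - v\<bar>\<close>, and uniform continuity of the Gibbs
  states makes the other factor as small as desired.\<close>

lemma uniform_work_error:
  assumes "0 < \<eta>"
  obtains \<delta> where "0 < \<delta>" "\<And>u v b. u \<in> {0..1} \<Longrightarrow> v \<in> {0..1} \<Longrightarrow> \<bar>u - v\<bar> < \<delta> \<Longrightarrow> b \<in> {0..B}
    \<Longrightarrow> b * energy (H v - H u) (gibbs b (H u) - gibbs b (H v)) \<le> \<eta> * \<bar>u - v\<bar>"
proof -
  obtain C where C: "0 < C" "\<And>A \<rho> :: 'n cmat. norm (energy A \<rho>) \<le> norm A * norm \<rho> * C"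
    using bounded_bilinear.pos_bounded[OF bounded_bilinear_energy] by blast
  have L0: "0 \<le> L" using lipschitz by (rule lipschitz_on_nonneg)
  \<comment> \<open>\<open>M\<close> collects the bounds for \<open>b\<close>, for the Lipschitz
    constant and for \<open>energy\<close>; the summands \<open>1\<close> keep it positive.\<close>
  define M where "M = (\<bar>B\<bar> + 1) * (L + 1) * C"
  have M: "0 < M" using C(1) L0 by (simp add: M_def)
  have "uniformly_continuous_on ({0..B} \<times> {0..1}) (\<lambda>z. gibbs (fst z) (H (snd z)))"
    by (intro compact_uniformly_continuous continuous_on_gibbs_path continuous_intros compact_Times) auto
  then obtain \<delta> where \<delta>: "0 < \<delta>" "\<And>z z'. z \<in> {0..B} \<times> {0..1} \<Longrightarrow> z' \<in> {0..B} \<times> {0..1} \<Longrightarrow> dist z' z < \<delta>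
      \<Longrightarrow> dist (gibbs (fst z') (H (snd z'))) (gibbs (fst z) (H (snd z))) < \<eta> / M"
    unfolding uniformly_continuous_on_def using divide_pos_pos[OF assms M] by metis
  show ?thesis
  proof (rule that[OF \<delta>(1)])
    fix u v b :: real
    assume uv: "u \<in> {0..1}" "v \<in> {0..1}" "\<bar>u - v\<bar> < \<delta>" and b: "b \<in> {0..B}"
    have "norm (gibbs b (H u) - gibbs b (H v)) \<le> \<eta> / M"
      using \<delta>(2)[of "(b, v)" "(b, u)"] uv b by (simp add: dist_Pair_Pair dist_norm)
    moreover have "norm (H v - H u) \<le> (L + 1) * \<bar>u - v\<bar>"
      using lipschitz_onD[OF lipschitz uv(2,1)]
      by (simp add: dist_norm abs_minus_commute algebra_simps)
    ultimately have "norm (H v - H u) * norm (gibbs b (H u) - gibbs b (H v)) * C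
        \<le> ((L + 1) * \<bar>u - v\<bar>) * (\<eta> / M) * C"
      using C(1) L0 by (intro mult_right_mono mult_mono) auto
    then have "energy (H v - H u) (gibbs b (H u) - gibbs b (H v)) \<le> ((L + 1) * \<bar>u - v\<bar>) * (\<eta> / M) * C"
      using C(2)[of "H v - H u" "gibbs b (H u) - gibbs b (H v)"] by simp
    then have "b * energy (H v - H u) (gibbs b (H u) - gibbs b (H v))
        \<le> b * (((L + 1) * \<bar>u - v\<bar>) * (\<eta> / M) * C)"
      using b by (intro mult_left_mono) auto
    also have "\<dots> \<le> (\<bar>B\<bar> + 1) * (((L + 1) * \<bar>u - v\<bar>) * (\<eta> / M) * C)"
      using b C(1) L0 M assms by (intro mult_right_mono) auto
    also have "\<dots> = \<eta> * \<bar>u - v\<bar>"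
      using M by (simp add: M_def field_simps)
    finally show "b * energy (H v - H u) (gibbs b (H u) - gibbs b (H v)) \<le> \<eta> * \<bar>u - v\<bar>" .
  qed
qed

text \<open>The lower bound is the maximum entropy principle at equal energies. For the upper bound
  two Gibbs inequalities are chained through \<open>gibbs b (H v)\<close>, which has the old inverse
  temperature and the new Hamiltonian.\<close>

lemma equilibration_entropy_bounds:
  assumes uv: "u \<in> {0..1}" "v \<in> {0..1}" and b: "0 \<le> b" "0 \<le> c"
    and eq: "energy (H v) (gibbs c (H v)) = energy (H v) (gibbs b (H u))"
  shows "ent b u \<le> ent c v"
    and "ent c v \<le> ent b u + b * energy (H v - H u) (gibbs b (H u) - gibbs b (H v))"
proof -
  note herm = hermitian_path[OF uv(1)] hermitian_path[OF uv(2)]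
  show "ent b u \<le> ent c v"
    using gibbs_inequality(1)[OF herm(2,1), of b c] eq by (simp add: ent_def)
  have "ent c v \<le> ent b v + b * (energy (H v) (gibbs b (H u)) - energy (H v) (gibbs b (H v)))"
    using gibbs_inequality(1)[OF herm(2,2), of c b] eq by (simp add: ent_def)
  moreover have "ent b v \<le> ent b u + b * (energy (H u) (gibbs b (H v)) - energy (H u) (gibbs b (H u)))"
    using gibbs_inequality(1)[OF herm(1,2), of b b] by (simp add: ent_def)
  moreover have "energy (H v - H u) (gibbs b (H u) - gibbs b (H v))
      = (energy (H v) (gibbs b (H u)) - energy (H v) (gibbs b (H v)))
      + (energy (H u) (gibbs b (H v)) - energy (H u) (gibbs b (H u)))"
    by (simp add: bounded_bilinear.diff_left[OF bounded_bilinear_energy]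
        bounded_bilinear.diff_right[OF bounded_bilinear_energy])
  ultimately show "ent c v \<le> ent b u + b * energy (H v - H u) (gibbs b (H u) - gibbs b (H v))"
    by (simp add: distrib_left)
qed

text \<open>Intermediate value theorem for the energy between inverse temperatures \<open>0\<close>
  and \<open>B\<close>. At \<open>B\<close> the energy is too low by the Gibbs inequality, since the
  entropy there is less than that of the state before the step.\<close>

lemma equilibrium_exists:
  assumes uv: "u \<in> {0..1}" "v \<in> {0..1}" and B: "0 < B" "ent B v < ent b u"
    and gap: "energy (H v) (gibbs b (H u)) < energy (H v) (gibbs 0 (H v))"
  shows "\<exists>c. equilibrium_beta (gibbs b (H u)) (H v) c"
proof -
  note herm = hermitian_path[OF uv(1)] hermitian_path[OF uv(2)]
  have "0 < B * (energy (H v) (gibbs b (H u)) - energy (H v) (gibbs B (H v)))"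
    using gibbs_inequality(1)[OF herm(2,1), of b B] B(2) by (simp add: ent_def)
  then have lo: "energy (H v) (gibbs B (H v)) < energy (H v) (gibbs b (H u))"
    using B(1) by (simp add: zero_less_mult_iff)
  have "continuous_on {0..B} (\<lambda>c. energy (H v) (gibbs c (H v)))"
    using uv by (intro continuous_intros continuous_on_gibbs_path) auto
  then obtain c where c: "0 \<le> c" "energy (H v) (gibbs c (H v)) = energy (H v) (gibbs b (H u))"
    using IVT2'[of "\<lambda>c. energy (H v) (gibbs c (H v))" B "energy (H v) (gibbs b (H u))" 0] lo gap B(1)
    by auto
  moreover have "c \<noteq> 0" using c gap by auto
  ultimately show ?thesis
    by (intro exI[of _ c]) (simp add: equilibrium_beta_gibbs herm)
qed

text \<open>A step never lowers the entropy and raises it by at most \<open>\<mu> / N\<close>, so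
  \<open>m\<close> steps produce at most \<open>\<mu> * (m / N)\<close>. Entropies in
  \<open>{s..t}\<close> in turn confine the inverse temperature to \<open>{\<epsilon>..B}\<close>,
  where the uniform estimates for the next step hold.\<close>

lemma process_entropy_bounds:
  assumes "0 < \<eta>"
  shows "\<forall>\<^sub>F N in sequentially. gibbs_process_well_defined H (gibbs \<beta>0 (H 0)) N
    \<and> (\<forall>m\<le>N. \<exists>b>0. gibbs_process H (gibbs \<beta>0 (H 0)) N m = gibbs b (H (real m / real N))
        \<and> s \<le> ent b (real m / real N) \<and> ent b (real m / real N) \<le> s + \<eta>)"
proof -
  \<comment> \<open>A ceiling strictly between \<open>s\<close> and the maximal entropy keeps the
    inverse temperatures away from \<open>0\<close>.\<close>
  define t where "t = (s + ln CARD('n)) / 2"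
  have t: "s < t" "t < ln CARD('n)" using s_less by (auto simp: t_def)
  obtain B where B: "0 < B" "\<And>u. u \<in> {0..1} \<Longrightarrow> ent B u < s"
    using uniform_low_entropy by blast
  obtain \<epsilon> where \<epsilon>: "0 < \<epsilon>" "\<And>u. u \<in> {0..1} \<Longrightarrow> t < ent \<epsilon> u"
    using uniform_high_entropy[OF t(2)] by blast
  have range: "b \<in> {\<epsilon>..B}" if "u \<in> {0..1}" "0 < b" "s \<le> ent b u" "ent b u \<le> t" for b u
  proof -
    have "\<not> b < \<epsilon>" using ent_strict_decreasing[of u b \<epsilon>] \<epsilon>(2)[of u] that by force
    moreover have "\<not> B < b" using ent_strict_decreasing[of u B b] B that by force
    ultimately show ?thesis by simp
  qed
  \<comment> \<open>The cap \<open>t - s\<close> ensures that the entropy accumulated over all steps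
    does not exceed \<open>t\<close>.\<close>
  define \<mu> where "\<mu> = min \<eta> (t - s)"
  have \<mu>: "0 < \<mu>" "\<mu> \<le> \<eta>" "s + \<mu> \<le> t" using assms t by (auto simp: \<mu>_def)
  obtain \<delta>1 where \<delta>1: "0 < \<delta>1" "\<And>u v b. u \<in> {0..1} \<Longrightarrow> v \<in> {0..1} \<Longrightarrow> \<bar>u - v\<bar> < \<delta>1 \<Longrightarrow> b \<in> {\<epsilon>..B}
    \<Longrightarrow> energy (H v) (gibbs b (H u)) < energy (H v) (gibbs 0 (H v))"
    using uniform_energy_gap[OF \<epsilon>(1)] by blast
  obtain \<delta>2 where \<delta>2: "0 < \<delta>2" "\<And>u v b. u \<in> {0..1} \<Longrightarrow> v \<in> {0..1} \<Longrightarrow> \<bar>u - v\<bar> < \<delta>2 \<Longrightarrow> b \<in> {0..B}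
    \<Longrightarrow> b * energy (H v - H u) (gibbs b (H u) - gibbs b (H v)) \<le> \<mu> * \<bar>u - v\<bar>"
    using uniform_work_error[OF \<mu>(1)] by blast
  have "\<forall>\<^sub>F N in sequentially. 1 / min \<delta>1 \<delta>2 < real N"
    using filterlim_real_sequentially by (simp add: filterlim_at_top_dense)
  then show ?thesis
  proof eventually_elim
    case (elim N)
    have min0: "0 < min \<delta>1 \<delta>2" using \<delta>1(1) \<delta>2(1) by simp
    then have "0 < 1 / min \<delta>1 \<delta>2" by simp
    with elim have N0: "0 < real N" by linarith
    have "1 / x < y" if "1 / y < x" "0 < x" "0 < y" for x y :: real
      using that by (simp add: field_simps)
    from this[OF elim N0 min0] have N: "1 / real N < \<delta>1" "1 / real N < \<delta>2"
      using min.strict_boundedE by blast+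
    let ?P = "gibbs_process H (gibbs \<beta>0 (H 0)) N"
    let ?Q = "\<lambda>m. \<exists>b>0. ?P m = gibbs b (H (real m / real N)) \<and> s \<le> ent b (real m / real N)
        \<and> ent b (real m / real N) \<le> s + \<mu> * (real m / real N)"
    have step: "(\<exists>c. equilibrium_beta (?P m) (H (real (Suc m) / real N)) c) \<and> ?Q (Suc m)"
      if m: "m < N" and Q: "?Q m" for m
    proof -
      define u where "u = real m / real N"
      define v where "v = real (Suc m) / real N"
      have uv: "u \<in> {0..1}" "v \<in> {0..1}" using m N0 by (auto simp: u_def v_def)
      have dv: "\<bar>u - v\<bar> = 1 / real N" using N0 by (simp add: u_def v_def field_simps)
      obtain b where b: "0 < b" "?P m = gibbs b (H u)" "s \<le> ent b u" "ent b u \<le> s + \<mu> * u"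
        using Q by (auto simp: u_def)
      have "\<mu> * u \<le> \<mu>" using uv(1) \<mu>(1) by (simp add: mult_left_le)
      then have bR: "b \<in> {\<epsilon>..B}"
        using b \<mu>(3) by (intro range[OF uv(1)]) auto
      have ex: "\<exists>c. equilibrium_beta (gibbs b (H u)) (H v) c"
        using B(2)[OF uv(2)] b(3) N dv bR
        by (intro equilibrium_exists[OF uv B(1)] \<delta>1(2)[OF uv]) auto
      \<comment> \<open>The same choice as in \<open>Omega_Gibbs\<close>, so that
        \<open>gibbs c (H v)\<close> is the next state of the process.\<close>
      define c where "c = (SOME c. equilibrium_beta (gibbs b (H u)) (H v) c)"
      have "equilibrium_beta (gibbs b (H u)) (H v) c"
        unfolding c_def using ex by (rule someI_ex)
      then have c: "0 < c" "energy (H v) (gibbs c (H v)) = energy (H v) (gibbs b (H u))"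
        using uv by (auto simp: equilibrium_beta_gibbs hermitian_path)
      have "s \<le> ent c v"
        using equilibration_entropy_bounds(1)[OF uv _ _ c(2)] b c by simp
      moreover have "ent c v \<le> s + \<mu> * v"
      proof -
        have "ent c v \<le> ent b u + b * energy (H v - H u) (gibbs b (H u) - gibbs b (H v))"
          using b c by (intro equilibration_entropy_bounds(2)[OF uv _ _ c(2)]) auto
        also have "\<dots> \<le> ent b u + \<mu> * \<bar>u - v\<bar>"
          using \<delta>2(2)[OF uv, of b] N(2) dv bR \<epsilon>(1) by auto
        also have "\<dots> \<le> s + \<mu> * u + \<mu> * \<bar>u - v\<bar>" using b(4) by simp
        also have "\<dots> = s + \<mu> * v"
          using N0 by (simp add: dv) (simp add: u_def v_def field_simps)
        finally show ?thesis .
      qed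
      moreover have "?P (Suc m) = gibbs c (H v)"
        by (simp add: b(2) Omega_Gibbs_def c_def v_def)
      ultimately show ?thesis
        using c(1) ex b(2) unfolding v_def by auto
    qed
    have Q: "?Q m" if "m \<le> N" for m
      using that
    proof (induction m)
      case 0
      then show ?case using start \<beta>0_pos by (auto simp: ent_def)
    next
      case (Suc m)
      then show ?case using step by simp
    qed
    have "gibbs_process_well_defined H (gibbs \<beta>0 (H 0)) N"
      unfolding gibbs_process_well_defined_def using step Q by (simp add: less_imp_le)
    moreover have "\<exists>b>0. ?P m = gibbs b (H (real m / real N)) \<and> s \<le> ent b (real m / real N)
        \<and> ent b (real m / real N) \<le> s + \<eta>" if m: "m \<le> N" for m
    proof -
      obtain b where b: "0 < b" "?P m = gibbs b (H (real m / real N))" "s \<le> ent b (real m / real N)"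
        "ent b (real m / real N) \<le> s + \<mu> * (real m / real N)"
        using Q[OF m] by blast
      have "real m / real N \<le> 1" using m N0 by simp
      then have "\<mu> * (real m / real N) \<le> \<mu>" using \<mu>(1) by (intro mult_left_le) auto
      then show ?thesis using b \<mu>(2) by force
    qed
    ultimately show ?case by blast
  qed
qed

lemma isentropic_beta:
  assumes u: "u \<in> {0..1}"
  obtains b where "0 < b" "ent b u = s"
proof -
  obtain \<beta> where \<beta>: "0 < \<beta>" "ent \<beta> u < s"
    using low_entropy[OF u] by (auto simp: ent_def)
  have "continuous_on {0..\<beta>} (\<lambda>b. ent b u)"
    unfolding ent_def using u by (intro continuous_on_vn_entropy_gibbs continuous_intros hermitian_path)
  then obtain b where b: "0 \<le> b" "ent b u = s"
    using IVT2'[of "\<lambda>b. ent b u" \<beta> s 0] \<beta> ent_0[OF u] s_less by auto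
  moreover have "b \<noteq> 0" using b ent_0[OF u] s_less by auto
  ultimately show ?thesis by (intro that[of b]) auto
qed

text \<open>The entropies of the process tend to \<open>s\<close>. As \<open>ent\<close> is strictly
  decreasing in the inverse temperature, the inverse temperatures must converge to the isentropic
  one, and by continuity so do the states.\<close>

lemma process_tendsto:
  assumes u: "u \<in> {0..1}" and b: "0 < b" "ent b u = s"
  shows "(\<lambda>N. gibbs_process H (gibbs \<beta>0 (H 0)) N (nat \<lfloor>u * real N\<rfloor>)) \<longlonglongrightarrow> gibbs b (H u)"
proof -
  define v where "v N = real (nat \<lfloor>u * real N\<rfloor>) / real N" for N :: nat
  let ?P = "\<lambda>N. gibbs_process H (gibbs \<beta>0 (H 0)) N (nat \<lfloor>u * real N\<rfloor>)"
  have le: "nat \<lfloor>u * real N\<rfloor> \<le> N" for N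
  proof -
    have "u * real N \<le> real N" using u by (simp add: mult_left_le_one_le)
    then show ?thesis by (simp add: nat_le_iff floor_le_iff)
  qed
  \<comment> \<open>For \<open>N = 0\<close> division by zero makes \<open>v N = 0\<close>, which
    still lies in the interval.\<close>
  have v01: "v N \<in> {0..1}" for N
    using le[of N] by (cases "N = 0") (auto simp: v_def)
  have v: "v \<longlonglongrightarrow> u"
  proof (rule LIM_zero_cancel, rule Lim_null_comparison)
    show "\<forall>\<^sub>F N in sequentially. norm (v N - u) \<le> 1 / real N"
      using eventually_gt_at_top[of 0]
    proof eventually_elim
      case (elim N)
      have "real (nat \<lfloor>u * real N\<rfloor>) = of_int \<lfloor>u * real N\<rfloor>" using u by simp
      then have "\<bar>real (nat \<lfloor>u * real N\<rfloor>) - u * real N\<bar> \<le> 1" by linarith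
      moreover have "v N - u = (real (nat \<lfloor>u * real N\<rfloor>) - u * real N) / real N"
        using elim by (simp add: v_def field_simps)
      ultimately show ?case using elim by (simp add: divide_right_mono)
    qed
  qed (rule lim_1_over_n)
  define \<beta> where "\<beta> N = (SOME c. 0 < c \<and> ?P N = gibbs c (H (v N)) \<and> ent c (v N) \<le> s + 1 \<and> s \<le> ent c (v N))" for N
  have \<beta>: "\<forall>\<^sub>F N in sequentially. 0 < \<beta> N \<and> ?P N = gibbs (\<beta> N) (H (v N)) \<and> s \<le> ent (\<beta> N) (v N)"
    using process_entropy_bounds[of 1, simplified]
  proof eventually_elim
    case (elim N)
    then have "\<exists>c. 0 < c \<and> ?P N = gibbs c (H (v N)) \<and> ent c (v N) \<le> s + 1 \<and> s \<le> ent c (v N)"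
      using le[of N] unfolding v_def by blast
    from someI_ex[OF this] show ?case by (simp add: \<beta>_def)
  qed
  \<comment> \<open>The inverse temperature supplied by \<open>process_entropy_bounds\<close> may
    differ from \<open>\<beta> N\<close>, but both give the same state and hence the same
    entropy.\<close>
  have ent_le: "\<forall>\<^sub>F N in sequentially. ent (\<beta> N) (v N) < s + \<eta>" if "0 < \<eta>" for \<eta>
    using process_entropy_bounds[OF half_gt_zero[OF that]] \<beta>
  proof eventually_elim
    case (elim N)
    then obtain c where "?P N = gibbs c (H (v N))" "ent c (v N) \<le> s + \<eta> / 2"
      using le[of N] that unfolding v_def by (meson half_gt_zero)
    then show ?case using elim that by (simp add: ent_def)
  qed
  have ent_lim: "(\<lambda>N. ent (\<beta> N) (v N)) \<longlonglongrightarrow> s"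
  proof (rule order_tendstoI)
    fix a assume "a < s"
    show "\<forall>\<^sub>F N in sequentially. a < ent (\<beta> N) (v N)"
      using \<beta> by eventually_elim (use \<open>a < s\<close> in auto)
  next
    fix a assume "s < a"
    then show "\<forall>\<^sub>F N in sequentially. ent (\<beta> N) (v N) < a"
      using ent_le[of "a - s"] by simp
  qed
  \<comment> \<open>The sign of the limit \<open>ent a u - s\<close> decides on which side of
    \<open>a\<close> the \<open>\<beta> N\<close> eventually lie.\<close>
  have ent_const: "(\<lambda>N. ent a (v N) - ent (\<beta> N) (v N)) \<longlonglongrightarrow> ent a u - s" for a
    using v01 by (intro tendsto_diff ent_lim tendsto_ent v u) auto
  have "\<beta> \<longlonglongrightarrow> b"
  proof (rule order_tendstoI)
    fix a assume a: "a < b"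
    \<comment> \<open>The monotonicity of \<open>ent\<close> is available for nonnegative arguments
      only; for negative \<open>a\<close> the positivity of \<open>\<beta> N\<close>
      suffices.\<close>
    show "\<forall>\<^sub>F N in sequentially. a < \<beta> N"
    proof (cases "a < 0")
      case True
      show ?thesis using \<beta> by eventually_elim (use True in auto)
    next
      case False
      then have "0 < ent a u - s" using ent_strict_decreasing[OF u _ a] b(2) by simp
      from order_tendstoD(1)[OF ent_const this] \<beta> show ?thesis
      proof eventually_elim
        case (elim N)
        have "\<beta> N \<noteq> a" using elim by auto
        moreover have "\<not> \<beta> N < a" using ent_strict_decreasing[OF v01[of N], of "\<beta> N" a] elim by auto
        ultimately show ?case by simp
      qed
    qed
  next
    fix a assume a: "b < a"
    then have "ent a u - s < 0" using ent_strict_decreasing[OF u _ a] b by simp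
    from order_tendstoD(2)[OF ent_const this] show "\<forall>\<^sub>F N in sequentially. \<beta> N < a"
    proof eventually_elim
      case (elim N)
      have "\<beta> N \<noteq> a" using elim by auto
      moreover have "\<not> a < \<beta> N" using ent_strict_decreasing[OF v01[of N], of a "\<beta> N"] elim a b by auto
      ultimately show ?case by simp
    qed
  qed
  have cont: "continuous_on (UNIV \<times> {0..1}) (\<lambda>z. gibbs (fst z) (H (snd z)))"
    by (intro continuous_on_gibbs_path continuous_intros) auto
  have "(\<lambda>N. gibbs (\<beta> N) (H (v N))) \<longlonglongrightarrow> gibbs b (H u)"
    using continuous_on_tendsto_compose[OF cont tendsto_Pair[OF \<open>\<beta> \<longlonglongrightarrow> b\<close> v]] u v01 by simp
  moreover have "\<forall>\<^sub>F N in sequentially. gibbs (\<beta> N) (H (v N)) = ?P N"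
    using \<beta> by eventually_elim simp
  ultimately show ?thesis by (rule Lim_transform_eventually)
qed

lemma isentropic_process:
  assumes "smooth_on_unit H"
  shows "\<exists>\<omega>. quasi_static H (gibbs \<beta>0 (H 0)) \<omega> \<and> no_entropy_production \<omega>"
proof -
  have "\<forall>u. \<exists>b. u \<in> {0..1} \<longrightarrow> 0 < b \<and> ent b u = s"
    using isentropic_beta by metis
  then obtain b where b: "\<And>u. u \<in> {0..1} \<Longrightarrow> 0 < b u" "\<And>u. u \<in> {0..1} \<Longrightarrow> ent (b u) u = s"
    by metis
  have "\<forall>\<^sub>F N in sequentially. gibbs_process_well_defined H (gibbs \<beta>0 (H 0)) N"
    using process_entropy_bounds[of 1, simplified] by eventually_elim simp
  then have "quasi_static H (gibbs \<beta>0 (H 0)) (\<lambda>u. gibbs (b u) (H u))"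
    unfolding quasi_static_def using assms hermitian_path process_tendsto b by blast
  moreover have "no_entropy_production (\<lambda>u. gibbs (b u) (H u))"
    using b(2)[of 0] b(2)[of 1] by (simp add: no_entropy_production_def ent_def)
  ultimately show ?thesis by blast
qed

end

section \<open>The trajectory\<close>

text \<open>The derivatives of all orders come from iterating \<open>pderiv\<close>; the trajectory
  below is a sum of such terms.\<close>

lemma smooth_on_unit_poly_scaleR: "smooth_on_unit (\<lambda>u. poly p u *\<^sub>R A)"
  unfolding smooth_on_unit_def
proof (intro exI conjI ballI allI)
  fix k and u :: real
  have "((\<lambda>u. poly ((pderiv ^^ k) p) u) has_vector_derivative poly (pderiv ((pderiv ^^ k) p)) u) (at u within {0..1})"
    by (simp add: has_real_derivative_iff_has_vector_derivative[symmetric] poly_DERIV has_field_derivative_at_within)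
  from bounded_linear.has_vector_derivative[OF bounded_linear_scaleR_left this]
  show "((\<lambda>u. poly ((pderiv ^^ k) p) u *\<^sub>R A) has_vector_derivative poly ((pderiv ^^ Suc k) p) u *\<^sub>R A)
      (at u within {0..1})"
    by simp
qed simp

lemma smooth_on_unit_add:
  assumes "smooth_on_unit f" "smooth_on_unit g"
  shows "smooth_on_unit (\<lambda>u. f u + g u)"
proof -
  obtain D D' where
    "\<forall>u\<in>{0..1}. D 0 u = f u" "\<forall>k. \<forall>u\<in>{0..1}. (D k has_vector_derivative D (Suc k) u) (at u within {0..1})"
    "\<forall>u\<in>{0..1}. D' 0 u = g u" "\<forall>k. \<forall>u\<in>{0..1}. (D' k has_vector_derivative D' (Suc k) u) (at u within {0..1})"
    using assms unfolding smooth_on_unit_def by blast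
  then show ?thesis
    unfolding smooth_on_unit_def
    by (intro exI[of _ "\<lambda>k u. D k u + D' k u"]) (auto intro!: has_vector_derivative_add)
qed

lemma smooth_on_unit_imp_lipschitz:
  assumes "smooth_on_unit f"
  obtains L where "L-lipschitz_on {0..1} f"
proof -
  obtain D where D0: "\<And>u. u \<in> {0..1} \<Longrightarrow> D 0 u = f u"
    and D: "\<And>k u. u \<in> {0..1} \<Longrightarrow> (D k has_vector_derivative D (Suc k) u) (at u within {0..1})"
    using assms unfolding smooth_on_unit_def by blast
  have "continuous_on {0..1} (D 1)"
    unfolding continuous_on_eq_continuous_within
    using D has_vector_derivative_continuous by blast
  then have "bounded (D 1 ` {0..1})"
    by (intro compact_imp_bounded compact_continuous_image) auto
  then obtain L where "\<forall>x \<in> D 1 ` {0..1}. norm x \<le> L"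
    unfolding bounded_iff by blast
  then have L: "\<And>u. u \<in> {0..1} \<Longrightarrow> norm (D 1 u) \<le> L"
    by blast
  have "0 \<le> L" using L[of 0] norm_ge_zero[of "D 1 0"] by (simp only: atLeastAtMost_iff) linarith
  have "L-lipschitz_on {0..1} (D 0)"
  proof (rule bounded_derivative_imp_lipschitz)
    show "(D 0 has_derivative (\<lambda>x. x *\<^sub>R D 1 u)) (at u within {0..1})" if "u \<in> {0..1}" for u
      using D[OF that, of 0] by (simp add: has_vector_derivative_def)
    show "onorm (\<lambda>x. x *\<^sub>R D 1 u) \<le> L" if "u \<in> {0..1}" for u
      using mult_right_mono[OF L[OF that] abs_ge_zero] by (intro onorm_le) (simp add: mult.commute)
  qed (use \<open>0 \<le> L\<close> in auto)
  then have "L-lipschitz_on {0..1} f"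
    unfolding lipschitz_on_def using D0 by simp
  then show ?thesis by (rule that)
qed

section \<open>Quadratic forms, ground states and low temperatures\<close>

lemma diag_mat_vec_nth: "(diag_mat d *v z) $ i = complex_of_real (d i) * z $ i"
  by (simp add: matrix_vector_mult_def diag_mat_def if_distrib if_distribR cong: if_cong)

lemma quadratic_form_conj_diag:
  fixes z :: "complex ^ 'n::finite"
  assumes U: "unitary U"
  shows "inner (U *v z) ((U ** diag_mat d ** adjoint_mat U) *v (U *v z)) = (\<Sum>i\<in>UNIV. d i * (cmod (z $ i))\<^sup>2)"
    and "inner (U *v z) (U *v z) = (\<Sum>i\<in>UNIV. (cmod (z $ i))\<^sup>2)"
proof -
  have iso: "hinner (U *v x) (U *v y) = hinner x y" for x y
    by (simp add: hinner_adjoint matrix_vector_mul_assoc unitaryD[OF U])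
  have "(U ** diag_mat d ** adjoint_mat U) *v (U *v z) = U ** diag_mat d ** (adjoint_mat U ** U) *v z"
    by (simp only: matrix_vector_mul_assoc matrix_mul_assoc)
  also have "\<dots> = U *v (diag_mat d *v z)"
    by (simp add: unitaryD[OF U] matrix_vector_mul_assoc)
  finally have "inner (U *v z) ((U ** diag_mat d ** adjoint_mat U) *v (U *v z)) = Re (hinner z (diag_mat d *v z))"
    by (simp only: inner_eq_Re_hinner iso)
  moreover have "cnj w * (of_real r * w) = of_real (r * (cmod w)\<^sup>2)" for w r
    by (simp add: complex_norm_square mult_ac del: of_real_power)
  ultimately show "inner (U *v z) ((U ** diag_mat d ** adjoint_mat U) *v (U *v z)) = (\<Sum>i\<in>UNIV. d i * (cmod (z $ i))\<^sup>2)"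
    by (simp add: hinner_def diag_mat_vec_nth del: of_real_mult of_real_power)
  show "inner (U *v z) (U *v z) = (\<Sum>i\<in>UNIV. (cmod (z $ i))\<^sup>2)"
    unfolding inner_eq_Re_hinner iso
    by (simp add: inner_eq_Re_hinner[symmetric] inner_vec_def power2_norm_eq_inner)
qed

lemma unitary_surj:
  assumes "unitary U"
  shows "x = U *v (adjoint_mat U *v x)"
  by (simp add: matrix_vector_mul_assoc unitaryD[OF assms])

lemma sum_axis_one:
  "(\<Sum>k\<in>UNIV. d k * (cmod (axis i (1::complex) $ k))\<^sup>2) = (d i :: real)"
proof -
  have "(cmod (axis i (1::complex) $ k))\<^sup>2 = (if k = i then 1 else 0)" for k
    by (simp add: axis_def)
  then show ?thesis by (simp only:) (simp add: if_distrib cong: if_cong)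
qed

lemma ground_state_exists:
  fixes H :: "'n::finite cmat"
  assumes "hermitian H"
  obtains \<psi> and e :: real where "norm \<psi> = 1" "H *v \<psi> = e *\<^sub>R \<psi>" "\<And>x. e * inner x x \<le> inner x (H *v x)"
proof -
  obtain U d where U: "unitary U" and H: "H = U ** diag_mat d ** adjoint_mat U"
    using hermitian_diagonalization[OF assms] .
  obtain i where i: "\<And>k. d i \<le> d k"
    using ex_min_if_finite[of "range d"] by (metis finite_class.finite finite_imageI UNIV_I image_is_empty UNIV_not_empty imageE not_le rangeI)
  define \<psi> where "\<psi> = U *v axis i 1"
  have "inner \<psi> \<psi> = 1"
    unfolding \<psi>_def quadratic_form_conj_diag(2)[OF U] using sum_axis_one[of "\<lambda>_. 1"] by simp
  then have 1: "norm \<psi> = 1" by (simp add: norm_eq_1)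
  have "H *v \<psi> = U ** diag_mat d ** (adjoint_mat U ** U) *v axis i 1"
    by (simp only: H \<psi>_def matrix_vector_mul_assoc matrix_mul_assoc)
  also have "\<dots> = U *v (diag_mat d *v axis i 1)"
    by (simp add: unitaryD[OF U] matrix_vector_mul_assoc)
  also have "diag_mat d *v axis i 1 = d i *\<^sub>R axis i 1"
  proof -
    have "(diag_mat d *v axis i 1) $ k = (d i *\<^sub>R axis i 1) $ k" for k
      unfolding vector_scaleR_component
      by (simp add: diag_mat_vec_nth axis_def scaleR_conv_of_real)
    then show ?thesis by (simp add: vec_eq_iff)
  qed
  finally have 2: "H *v \<psi> = d i *\<^sub>R \<psi>"
    by (simp add: \<psi>_def matrix_vector_mult_scaleR)
  have "d i * inner x x \<le> inner x (H *v x)" for x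
  proof -
    define z where "z = adjoint_mat U *v x"
    have x: "x = U *v z" unfolding z_def by (rule unitary_surj[OF U])
    show ?thesis
      unfolding x H quadratic_form_conj_diag[OF U] sum_distrib_left
      by (intro sum_mono mult_right_mono i) simp
  qed
  with 1 2 show ?thesis by (rule that)
qed

text \<open>With energies measured from the ground level, the factors
  \<open>exp (- \<beta> * g i)\<close> converge to \<open>1\<close> at \<open>i0\<close> and to
  \<open>0\<close> elsewhere, so \<open>Z\<close> tends to \<open>1\<close> and every term of the
  entropy to \<open>0\<close>.\<close>

lemma vn_entropy_gibbs_tendsto_0:
  assumes U: "unitary U" and gap: "\<And>i. i \<noteq> i0 \<Longrightarrow> d i0 < d i"
  shows "((\<lambda>\<beta>. vn_entropy (gibbs \<beta> (U ** diag_mat d ** adjoint_mat U))) \<longlongrightarrow> 0) at_top"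
proof -
  define g where "g i = d i - d i0" for i
  define Z where "Z \<beta> = (\<Sum>i\<in>UNIV. exp (- \<beta> * g i))" for \<beta>
  have Z: "Z \<beta> > 0" for \<beta> by (simp add: Z_def sum_pos)
  have shift: "exp (- \<beta> * d i) = exp (- \<beta> * d i0) * exp (- \<beta> * g i)" for \<beta> i
    by (simp add: g_def exp_add[symmetric] algebra_simps)
  have sum_shift: "(\<Sum>i\<in>UNIV. exp (- \<beta> * d i)) = exp (- \<beta> * d i0) * Z \<beta>" for \<beta>
    unfolding Z_def sum_distrib_left by (intro sum.cong refl shift)
  have p: "boltzmann \<beta> d i = exp (- \<beta> * g i) / Z \<beta>" for \<beta> i
    unfolding boltzmann_def sum_shift by (subst shift) simp
  have ln_p: "ln (boltzmann \<beta> d i) = - \<beta> * g i - ln (Z \<beta>)" for \<beta> i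
    using Z[of \<beta>] by (simp add: p ln_div)
  have S: "vn_entropy (gibbs \<beta> (U ** diag_mat d ** adjoint_mat U))
      = (\<Sum>i\<in>UNIV. (\<beta> * g i * exp (- \<beta> * g i) + exp (- \<beta> * g i) * ln (Z \<beta>)) / Z \<beta>)" for \<beta>
    unfolding gibbs_conj_diag[OF U] vn_entropy_conj_diag[OF U] sum_negf[symmetric] ln_p
    unfolding p using Z[of \<beta>] by (intro sum.cong refl) (simp add: field_simps)
  have g0: "i \<noteq> i0 \<Longrightarrow> g i > 0" and g00: "g i0 = 0" for i using gap by (auto simp: g_def)
  have e: "((\<lambda>\<beta>. exp (- \<beta> * g i)) \<longlongrightarrow> (if i = i0 then 1 else 0)) at_top" for i
  proof (cases "i = i0")
    case False
    then have "g i > 0" by (rule g0)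
    then have "((\<lambda>\<beta>. exp (- \<beta> * g i)) \<longlongrightarrow> 0) at_top" by real_asymp
    then show ?thesis using False by simp
  qed (simp add: g00)
  have ge: "((\<lambda>\<beta>. \<beta> * g i * exp (- \<beta> * g i)) \<longlongrightarrow> 0) at_top" for i
  proof (cases "i = i0")
    case False
    then have "g i > 0" by (rule g0)
    then show ?thesis by real_asymp
  qed (simp add: g00)
  have "(Z \<longlongrightarrow> (\<Sum>i\<in>UNIV. if i = i0 then 1 else 0)) at_top"
    unfolding Z_def by (intro tendsto_sum e)
  then have Zlim: "(Z \<longlongrightarrow> 1) at_top" by simp
  have "((\<lambda>\<beta>. \<Sum>i\<in>UNIV. (\<beta> * g i * exp (- \<beta> * g i) + exp (- \<beta> * g i) * ln (Z \<beta>)) / Z \<beta>)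
      \<longlongrightarrow> (\<Sum>i\<in>UNIV. (0 + (if i = i0 then 1 else 0) * ln 1) / 1)) at_top"
    by (intro tendsto_intros e ge Zlim) auto
  then show ?thesis by (simp add: S)
qed

text \<open>
  The hypotheses say that \<open>K - e\<close> is negative somewhere but not on a hyperplane, so exactly one
  eigenvalue of \<open>K\<close> lies below \<open>e\<close>.
\<close>

lemma low_entropy_single_negative_direction:
  fixes K :: "'n::finite cmat"
  assumes K: "hermitian K"
    and orth: "\<And>x. hinner \<psi> x = 0 \<Longrightarrow> e * inner x x \<le> inner x (K *v x)"
    and neg: "inner y (K *v y) < e * inner y y"
    and s: "0 < s"
  shows "\<exists>\<beta>>0. vn_entropy (gibbs \<beta> K) < s"
proof -
  obtain U d where U: "unitary U" and Kd: "K = U ** diag_mat d ** adjoint_mat U"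
    using hermitian_diagonalization[OF K] .
  define \<phi> where "\<phi> = adjoint_mat U *v \<psi>"
  have orth': "e * (\<Sum>i\<in>UNIV. (cmod (z $ i))\<^sup>2) \<le> (\<Sum>i\<in>UNIV. d i * (cmod (z $ i))\<^sup>2)" if "hinner \<phi> z = 0" for z
    using orth[of "U *v z"] that
    unfolding Kd quadratic_form_conj_diag[OF U] by (simp add: hinner_adjoint \<phi>_def)
  have "\<exists>i0. d i0 < e"
  proof (rule ccontr)
    assume "\<not> ?thesis"
    then have ge: "e \<le> d i" for i by (simp add: not_less)
    define z where "z = adjoint_mat U *v y"
    have y: "y = U *v z" unfolding z_def by (rule unitary_surj[OF U])
    have "e * inner y y \<le> inner y (K *v y)"
      unfolding y Kd quadratic_form_conj_diag[OF U] sum_distrib_left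
      by (intro sum_mono mult_right_mono ge) simp
    with neg show False by simp
  qed
  then obtain i0 where i0: "d i0 < e" by blast
  \<comment> \<open>With two eigenvalues below \<open>e\<close>, the plane spanned by their
    eigenvectors would contain a nonzero vector orthogonal to \<open>\<phi>\<close>, on which the
    form is too small.\<close>
  have "e \<le> d i" if i: "i \<noteq> i0" for i
  proof (rule ccontr)
    assume "\<not> e \<le> d i"
    then have di: "d i < e" by simp
    obtain a b where ab: "a \<noteq> 0 \<or> b \<noteq> 0" "cnj (\<phi> $ i) * a + cnj (\<phi> $ i0) * b = 0"
    proof (cases "\<phi> $ i = 0")
      case True
      then show ?thesis by (intro that[of 1 0]) auto
    next
      case False
      then show ?thesis by (intro that[of "cnj (\<phi> $ i0)" "- cnj (\<phi> $ i)"]) auto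
    qed
    define z where "z = (\<chi> k. if k = i then a else if k = i0 then b else 0)"
    have sum2: "(\<Sum>k\<in>UNIV. f k) = f i + f i0" if "\<And>k. k \<noteq> i \<Longrightarrow> k \<noteq> i0 \<Longrightarrow> f k = 0" for f :: "'n \<Rightarrow> 'c::comm_monoid_add"
    proof -
      have "(\<Sum>k\<in>UNIV. f k) = (\<Sum>k\<in>{i, i0}. f k)"
        using that by (intro sum.mono_neutral_right) auto
      then show ?thesis using i by simp
    qed
    have "hinner \<phi> z = 0"
      unfolding hinner_def by (subst sum2) (use ab i in \<open>auto simp: z_def\<close>)
    from orth'[OF this] have "e * ((cmod a)\<^sup>2 + (cmod b)\<^sup>2) \<le> d i * (cmod a)\<^sup>2 + d i0 * (cmod b)\<^sup>2"
      using i by (subst (asm) (1 2) sum2) (auto simp: z_def)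
    moreover have "d i * (cmod a)\<^sup>2 \<le> e * (cmod a)\<^sup>2" "d i0 * (cmod b)\<^sup>2 \<le> e * (cmod b)\<^sup>2"
      using di i0 by (auto intro!: mult_right_mono)
    moreover have "d i * (cmod a)\<^sup>2 < e * (cmod a)\<^sup>2 \<or> d i0 * (cmod b)\<^sup>2 < e * (cmod b)\<^sup>2"
      using ab(1) di i0 by auto
    ultimately show False by (simp add: distrib_left)
  qed
  then have "d i0 < d i" if "i \<noteq> i0" for i
    using that i0 by force
  from vn_entropy_gibbs_tendsto_0[OF U, of i0 d, OF this]
  have "\<forall>\<^sub>F \<beta> in at_top. vn_entropy (gibbs \<beta> K) < s"
    using s by (auto simp: Kd intro: order_tendstoD)
  with eventually_gt_at_top[of 0] have "\<forall>\<^sub>F \<beta> in at_top. 0 < \<beta> \<and> vn_entropy (gibbs \<beta> K) < s"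
    by (rule eventually_conj)
  from eventually_happens[OF this] show ?thesis by simp
qed

text \<open>The entropy is nonnegative, so lying below \<open>ln CARD('n)\<close> forces dimension
  at least two. Then every weight is strictly between \<open>0\<close> and \<open>1\<close> and
  contributes a positive term.\<close>

lemma vn_entropy_gibbs_pos:
  fixes H :: "'n::finite cmat"
  assumes "hermitian H" and less: "vn_entropy (gibbs \<beta> H) < ln CARD('n)"
  shows "0 < vn_entropy (gibbs \<beta> H)"
proof -
  obtain U d where U: "unitary U" and H: "H = U ** diag_mat d ** adjoint_mat U"
    using hermitian_diagonalization[OF assms(1)] .
  define p where "p = boltzmann \<beta> d"
  have p0: "0 < p i" for i by (simp add: p_def boltzmann_pos)
  have S: "vn_entropy (gibbs \<beta> H) = (\<Sum>i\<in>UNIV. p i * - ln (p i))"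
    unfolding H gibbs_conj_diag[OF U] vn_entropy_conj_diag[OF U] p_def by (simp add: sum_negf)
  have p1: "p i \<le> 1" for i
  proof -
    have "p i \<le> sum p UNIV" using p0 by (intro member_le_sum) (auto intro: less_imp_le)
    then show ?thesis by (simp add: p_def sum_boltzmann)
  qed
  have t0: "0 \<le> p i * - ln (p i)" for i
    using p0[of i] p1[of i] by (simp add: mult_nonneg_nonpos)
  have "0 \<le> vn_entropy (gibbs \<beta> H)" unfolding S by (intro sum_nonneg t0)
  with less have "0 < ln (real CARD('n))" by linarith
  then have "1 < CARD('n)" by (cases "CARD('n) = 0") auto
  then have "\<not> (\<forall>i\<in>UNIV. \<forall>j\<in>(UNIV :: 'n set). i = j)"
    using card_le_Suc0_iff_eq[of "UNIV :: 'n set"] by simp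
  then obtain i j :: 'n where ij: "i \<noteq> j" by blast
  have "p i < 1"
  proof -
    have "p i + p j = sum p {i, j}" using ij by simp
    also have "\<dots> \<le> sum p UNIV" using p0 by (intro sum_mono2) (auto intro: less_imp_le)
    finally show ?thesis using p0[of j] by (simp add: p_def sum_boltzmann)
  qed
  then have "0 < p i * - ln (p i)" using p0[of i] by (simp add: mult_pos_neg)
  also have "\<dots> \<le> vn_entropy (gibbs \<beta> H)"
    unfolding S using t0 by (intro member_le_sum) auto
  finally show ?thesis .
qed

section \<open>Rank-one operators\<close>

definition outer :: "complex ^ 'n::finite \<Rightarrow> complex ^ 'n \<Rightarrow> 'n cmat"
  where "outer \<phi> \<xi> = (\<chi> i j. \<phi> $ i * cnj (\<xi> $ j))"

lemma outer_mult: "outer \<phi> \<xi> *v x = hinner \<xi> x *s \<phi>"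
  by (simp add: vec_eq_iff outer_def matrix_vector_mult_def hinner_def sum_distrib_left mult_ac)

text \<open>Exhibits the rank-one term of the trajectory as a polynomial in \<open>u\<close> with
  fixed matrix coefficients.\<close>

lemma outer_combination:
  "outer (a *\<^sub>R \<phi> + b *\<^sub>R \<xi>) (a *\<^sub>R \<phi> + b *\<^sub>R \<xi>)
    = (a * a) *\<^sub>R outer \<phi> \<phi> + (a * b) *\<^sub>R (outer \<phi> \<xi> + outer \<xi> \<phi>) + (b * b) *\<^sub>R outer \<xi> \<xi>"
  unfolding vec_eq_iff vector_add_component vector_scaleR_component outer_def
  by (simp add: scaleR_conv_of_real algebra_simps)

lemma hermitian_add: "hermitian A \<Longrightarrow> hermitian B \<Longrightarrow> hermitian (A + B)"
  by (simp add: hermitian_def vec_eq_iff)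

lemma hermitian_scaleR: "hermitian A \<Longrightarrow> hermitian (r *\<^sub>R A)"
  by (simp add: hermitian_def vec_eq_iff)

lemma hermitian_outer: "hermitian (outer \<psi> \<psi>)"
  by (simp add: hermitian_def vec_eq_iff outer_def mult.commute)

lemma inner_outer: "inner x (outer \<psi> \<psi> *v x) = (cmod (hinner \<psi> x))\<^sup>2"
proof -
  have "hinner x (outer \<psi> \<psi> *v x) = hinner \<psi> x * cnj (hinner \<psi> x)"
    by (simp add: outer_mult hinner_scale_right cnj_hinner)
  also have "\<dots> = of_real ((cmod (hinner \<psi> x))\<^sup>2)" by (rule complex_norm_square[symmetric])
  finally show ?thesis unfolding inner_eq_Re_hinner by (simp del: of_real_power)
qed

lemma scaleR_matrix_vector_mult: "(r *\<^sub>R A) *v x = r *\<^sub>R (A *v x)" for A :: "'n::finite cmat"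
  unfolding vec_eq_iff vector_scaleR_component matrix_vector_mult_def
  by (simp add: scaleR_sum_right)

text \<open>At the end points a larger inverse temperature already has entropy below
  \<open>s\<close>; in between, the rank-one term creates a single lowest level. The trajectory thus
  fulfils the assumptions of \<open>entropy_path\<close>.\<close>

lemma isentropic_trajectory_exists:
  fixes H0 H1 :: "'n::finite cmat"
  assumes H0: "hermitian H0" and H1: "hermitian H1" and \<beta>: "0 < \<beta>0" "0 < \<beta>1"
    and eq: "vn_entropy (gibbs \<beta>0 H0) = vn_entropy (gibbs \<beta>1 H1)"
    and less: "vn_entropy (gibbs \<beta>0 H0) < ln CARD('n)"
  shows "\<exists>H \<omega>. H 0 = H0 \<and> H 1 = H1 \<and> quasi_static H (gibbs \<beta>0 H0) \<omega> \<and> no_entropy_production \<omega>"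
proof -
  define s where "s = vn_entropy (gibbs \<beta>0 H0)"
  have s0: "0 < s" unfolding s_def by (rule vn_entropy_gibbs_pos[OF H0 less])
  obtain \<psi>0 and e0 :: real where g0: "norm \<psi>0 = 1" "H0 *v \<psi>0 = e0 *\<^sub>R \<psi>0"
      "\<And>x. e0 * inner x x \<le> inner x (H0 *v x)"
    using ground_state_exists[OF H0] by blast
  obtain \<psi> and e1 :: real where g: "norm \<psi> = 1" "H1 *v \<psi> = e1 *\<^sub>R \<psi>"
      "\<And>x. e1 * inner x x \<le> inner x (H1 *v x)"
    using ground_state_exists[OF H1] by blast
  \<comment> \<open>The sign keeps the interpolated vector away from \<open>0\<close>.\<close>
  define \<psi>1 where "\<psi>1 = (if 0 \<le> inner \<psi>0 \<psi> then \<psi> else - \<psi>)"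
  have g1: "norm \<psi>1 = 1" "H1 *v \<psi>1 = e1 *\<^sub>R \<psi>1" "0 \<le> inner \<psi>0 \<psi>1"
    using g(1,2) matrix_vector_mult_scaleR[of H1 "-1" \<psi>] by (auto simp: \<psi>1_def)
  define q0 where "q0 x = inner x (H0 *v x) - e0 * inner x x" for x
  define q1 where "q1 x = inner x (H1 *v x) - e1 * inner x x" for x
  have q_nonneg: "0 \<le> q0 x" "0 \<le> q1 x" for x
    using g0(3)[of x] g(3)[of x] by (simp_all add: q0_def q1_def)
  \<comment> \<open>On \<open>\<psi> u\<close> the shifted convex combination of \<open>H0\<close>, \<open>H1\<close> is at most \<open>u (1 - u) (q0 \<psi>1 + q1 \<psi>0)\<close>,
    while the rank-one term is at least \<open>c u (1 - u) / 4\<close>.\<close>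
  define c where "c = 4 * (q0 \<psi>1 + q1 \<psi>0) + 4"
  define \<psi> where "\<psi> u = (1 - u) *\<^sub>R \<psi>0 + u *\<^sub>R \<psi>1" for u :: real
  define H where "H u = (1 - u) *\<^sub>R H0 + u *\<^sub>R H1 + (- c * u * (1 - u)) *\<^sub>R outer (\<psi> u) (\<psi> u)" for u :: real
  have herm: "hermitian (H u)" for u
    unfolding H_def by (intro hermitian_add hermitian_scaleR H0 H1 hermitian_outer)
  have p: "poly ([:0, - c:] * [:1, -1:] ^ 3) u = - c * u * (1 - u) * ((1 - u) * (1 - u))"
    "poly ([:0, - c:] * [:0, 1:] * [:1, -1:] ^ 2) u = - c * u * (1 - u) * ((1 - u) * u)"
    "poly ([:0, - c:] * [:0, 1:] ^ 2 * [:1, -1:]) u = - c * u * (1 - u) * (u * u)" for u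
    by (simp_all add: algebra_simps power2_eq_square power3_eq_cube)
  have "H = (\<lambda>u. poly [:1, -1:] u *\<^sub>R H0 + poly [:0, 1:] u *\<^sub>R H1
      + poly ([:0, - c:] * [:1, -1:] ^ 3) u *\<^sub>R outer \<psi>0 \<psi>0
      + poly ([:0, - c:] * [:0, 1:] * [:1, -1:] ^ 2) u *\<^sub>R (outer \<psi>0 \<psi>1 + outer \<psi>1 \<psi>0)
      + poly ([:0, - c:] * [:0, 1:] ^ 2 * [:1, -1:]) u *\<^sub>R outer \<psi>1 \<psi>1)"
    unfolding p H_def \<psi>_def outer_combination
    by (simp add: fun_eq_iff scaleR_add_right)
  then have smooth: "smooth_on_unit H"
    by (simp only:) (intro smooth_on_unit_add smooth_on_unit_poly_scaleR)
  have form: "inner x (H u *v x) = (1 - u) * inner x (H0 *v x) + u * inner x (H1 *v x)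
      - c * u * (1 - u) * (cmod (hinner (\<psi> u) x))\<^sup>2" for u x
    unfolding H_def matrix_vector_mult_add_rdistrib scaleR_matrix_vector_mult
    by (simp add: inner_add_right inner_diff_right inner_outer)
  have interior: "\<exists>\<beta>>0. vn_entropy (gibbs \<beta> (H u)) < s" if u: "0 < u" "u < 1" for u
  proof (rule low_entropy_single_negative_direction[OF herm _ _ s0])
    \<comment> \<open>On the hyperplane orthogonal to \<open>\<psi> u\<close> the rank-one term
      vanishes and the two ground state bounds add up.\<close>
    show "((1 - u) * e0 + u * e1) * inner x x \<le> inner x (H u *v x)" if "hinner (\<psi> u) x = 0" for x
    proof -
      have "(1 - u) * (e0 * inner x x) + u * (e1 * inner x x)
          \<le> (1 - u) * inner x (H0 *v x) + u * inner x (H1 *v x)"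
        using u by (intro add_mono mult_left_mono g0(3) g(3)) auto
      then show ?thesis using that by (simp add: form algebra_simps)
    qed
    show "inner (\<psi> u) (H u *v \<psi> u) < ((1 - u) * e0 + u * e1) * inner (\<psi> u) (\<psi> u)"
    proof -
      define k where "k = inner (\<psi> u) (\<psi> u)"
      have "inner \<psi>0 \<psi>0 = 1" "inner \<psi>1 \<psi>1 = 1"
        using g0(1) g1(1) by (simp_all add: norm_eq_1)
      then have "k = (1 - u)\<^sup>2 + u\<^sup>2 + 2 * (u * (1 - u) * inner \<psi>0 \<psi>1)"
        by (simp add: k_def \<psi>_def inner_add_left inner_add_right inner_commute power2_eq_square algebra_simps)
      moreover have "0 \<le> u * (1 - u) * inner \<psi>0 \<psi>1" using u g1(3) by simp
      moreover have "1 / 2 \<le> (1 - u)\<^sup>2 + u\<^sup>2"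
        using zero_le_power2[of "2 * u - 1"] by (simp add: power2_eq_square algebra_simps)
      ultimately have k: "1 / 2 \<le> k" by linarith
      then have "(1 / 2)\<^sup>2 \<le> k\<^sup>2" by (intro power_mono) auto
      then have k2: "1 / 4 \<le> k\<^sup>2" by (simp add: power2_eq_square)
      have "cmod (hinner (\<psi> u) (\<psi> u)) = k"
        by (simp add: hinner_self k_def power2_norm_eq_inner[symmetric] norm_power)
      then have f: "inner (\<psi> u) (H u *v \<psi> u) - ((1 - u) * e0 + u * e1) * k
          = (1 - u) * q0 (\<psi> u) + u * q1 (\<psi> u) - c * u * (1 - u) * k\<^sup>2"
        by (simp add: form q0_def q1_def k_def algebra_simps)
      have sym0: "inner a (H0 *v b) = inner (H0 *v a) b" for a b
        by (simp add: inner_eq_Re_hinner hinner_hermitian[OF H0])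
      have sym1: "inner a (H1 *v b) = inner (H1 *v a) b" for a b
        by (simp add: inner_eq_Re_hinner hinner_hermitian[OF H1])
      \<comment> \<open>As \<open>\<psi>0\<close> is an eigenvector for \<open>e0\<close>, its own
        contribution and the cross terms cancel; only the part along \<open>\<psi>1\<close>
        remains.\<close>
      have Q0: "q0 (\<psi> u) = u\<^sup>2 * q0 \<psi>1"
        using sym0[of \<psi>0 \<psi>1] sym0[of \<psi>0 \<psi>0]
        by (simp add: q0_def \<psi>_def g0(2) matrix_vector_right_distrib matrix_vector_mult_scaleR
            inner_add_left inner_add_right inner_commute power2_eq_square algebra_simps)
      have Q1: "q1 (\<psi> u) = (1 - u)\<^sup>2 * q1 \<psi>0"
        using sym1[of \<psi>1 \<psi>0] sym1[of \<psi>1 \<psi>1]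
        by (simp add: q1_def \<psi>_def g1(2) matrix_vector_right_distrib matrix_vector_mult_scaleR
            inner_add_left inner_add_right inner_commute power2_eq_square algebra_simps)
      have "(1 - u) * q0 (\<psi> u) + u * q1 (\<psi> u) = (u * (1 - u)) * (u * q0 \<psi>1 + (1 - u) * q1 \<psi>0)"
        unfolding Q0 Q1 by (simp add: power2_eq_square algebra_simps)
      also have "\<dots> \<le> (u * (1 - u)) * (1 * q0 \<psi>1 + 1 * q1 \<psi>0)"
        using u q_nonneg by (intro mult_left_mono add_mono mult_right_mono) auto
      also have "\<dots> < (u * (1 - u)) * (c * (1 / 4))"
        using u by (intro mult_strict_left_mono) (auto simp: c_def)
      also have "\<dots> \<le> (u * (1 - u)) * (c * k\<^sup>2)"
        using u k2 q_nonneg by (intro mult_left_mono) (auto simp: c_def)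
      finally show ?thesis
        using f by (simp add: k_def mult_ac)
    qed
  qed
  have H_ends: "H 0 = H0" "H 1 = H1" by (simp_all add: H_def)
  have low: "\<exists>\<beta>>0. vn_entropy (gibbs \<beta> (H u)) < s" if u01: "u \<in> {0..1}" for u
  proof -
    consider "u = 0" | "u = 1" | "0 < u \<and> u < 1" using u01 by fastforce
    then show ?thesis
    proof cases
      case 1
      \<comment> \<open>Any inverse temperature above \<open>\<beta>0\<close> would do, as the
        entropy is strictly decreasing.\<close>
      have "vn_entropy (gibbs (2 * \<beta>0) H0) < s"
        unfolding s_def using \<beta> by (intro vn_entropy_gibbs_strict_decreasing[OF H0 less]) auto
      then show ?thesis using 1 H_ends \<beta> by (intro exI[of _ "2 * \<beta>0"]) auto
    next
      case 2
      have "vn_entropy (gibbs (2 * \<beta>1) H1) < s"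
        unfolding s_def eq using \<beta>
        by (intro vn_entropy_gibbs_strict_decreasing[OF H1 less[unfolded eq]]) auto
      then show ?thesis using 2 H_ends \<beta> by (intro exI[of _ "2 * \<beta>1"]) auto
    next
      case 3
      then show ?thesis using interior by blast
    qed
  qed
  obtain L where "L-lipschitz_on {0..1} H"
    using smooth_on_unit_imp_lipschitz[OF smooth] .
  then interpret entropy_path H s L \<beta>0
    using herm low less \<beta> by unfold_locales (auto simp: s_def H_ends)
  show ?thesis using isentropic_process[OF smooth] H_ends by auto
qed

text \<open>All Gibbs states of scalar Hamiltonians are maximally mixed, so the process never moves,
  and every positive inverse temperature satisfies the energy condition; the witness below is
  \<open>1\<close>.\<close>

lemma scalar_trajectory:
  fixes H0 H1 :: "'n::finite cmat"
  assumes H0: "H0 = r0 *\<^sub>R mat 1" and H1: "H1 = r1 *\<^sub>R mat 1"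
  shows "\<exists>H \<omega>. H 0 = H0 \<and> H 1 = H1 \<and> quasi_static H (gibbs \<beta>0 H0) \<omega> \<and> no_entropy_production \<omega>"
proof -
  define r where "r u = (1 - u) * r0 + u * r1" for u :: real
  define H :: "real \<Rightarrow> 'n cmat" where "H u = r u *\<^sub>R mat 1" for u
  define G :: "'n cmat" where "G = (1 / CARD('n)) *\<^sub>R mat 1"
  have gibbs: "gibbs b (H u) = G" for b u
    unfolding H_def G_def by (rule gibbs_scalar)
  have ends: "H 0 = H0" "H 1 = H1" by (simp_all add: H_def r_def H0 H1)
  have herm: "hermitian (H u)" for u
    unfolding H_def by (metis hermitian_conj_diag scalar_conj_diag[OF unitary_mat_1])
  have "H = (\<lambda>u. poly [:r0, r1 - r0:] u *\<^sub>R mat 1)"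
    by (simp add: H_def r_def fun_eq_iff algebra_simps)
  then have smooth: "smooth_on_unit H"
    by (simp only: smooth_on_unit_poly_scaleR)
  have start: "gibbs \<beta>0 H0 = G" using gibbs[of \<beta>0 0] by (simp add: ends)
  have "gibbs_process H G N m = G" for N m
    by (induction m) (simp_all add: Omega_Gibbs_def gibbs)
  moreover have "equilibrium_beta G (H u) 1" for u
    using equilibrium_beta_gibbs[OF herm herm, of 1 u u 1] by (simp add: gibbs)
  ultimately have "quasi_static H (gibbs \<beta>0 H0) (\<lambda>_. G)"
    unfolding quasi_static_def gibbs_process_well_defined_def start
    using smooth herm gibbs by (auto intro!: always_eventually exI[of _ 1])
  moreover have "no_entropy_production (\<lambda>_. G)"
    by (simp add: no_entropy_production_def)
  ultimately show ?thesis using ends by blast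
qed

theorem mainTheorem3:
  fixes H0 H1 :: "complex ^ 'n::finite ^ 'n" and \<beta>0 :: real
  assumes "hermitian H0" and "hermitian H1" and "0 < \<beta>0"
  shows "(\<exists>H \<omega>. H 0 = H0 \<and> H 1 = H1 \<and> quasi_static H (gibbs \<beta>0 H0) \<omega> \<and> no_entropy_production \<omega>)
    \<longleftrightarrow> (\<exists>\<beta>>0. vn_entropy (gibbs \<beta>0 H0) = vn_entropy (gibbs \<beta> H1))"
proof
  assume "\<exists>H \<omega>. H 0 = H0 \<and> H 1 = H1 \<and> quasi_static H (gibbs \<beta>0 H0) \<omega> \<and> no_entropy_production \<omega>"
  then obtain H \<omega> where H: "H 1 = H1" and qs: "quasi_static H (gibbs \<beta>0 H0) \<omega>"
    and nep: "vn_entropy (\<omega> 1) = vn_entropy (\<omega> 0)"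
    by (auto simp: no_entropy_production_def)
  \<comment> \<open>At \<open>u = 0\<close> no step has been made, so the sequence is constantly the
    initial state.\<close>
  have "(\<lambda>N. gibbs_process H (gibbs \<beta>0 H0) N (nat \<lfloor>0 * real N\<rfloor>)) \<longlonglongrightarrow> \<omega> 0"
    using qs unfolding quasi_static_def by (metis atLeastAtMost_iff order_refl zero_le_one)
  then have "\<omega> 0 = gibbs \<beta>0 H0"
    by (simp add: LIMSEQ_const_iff)
  moreover obtain \<beta> where "0 < \<beta>" "\<omega> 1 = gibbs \<beta> H1"
    using qs H unfolding quasi_static_def by (metis atLeastAtMost_iff order_refl zero_le_one)
  ultimately show "\<exists>\<beta>>0. vn_entropy (gibbs \<beta>0 H0) = vn_entropy (gibbs \<beta> H1)"
    using nep by auto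
next
  assume "\<exists>\<beta>>0. vn_entropy (gibbs \<beta>0 H0) = vn_entropy (gibbs \<beta> H1)"
  then obtain \<beta> where \<beta>: "0 < \<beta>" "vn_entropy (gibbs \<beta>0 H0) = vn_entropy (gibbs \<beta> H1)"
    by blast
  show "\<exists>H \<omega>. H 0 = H0 \<and> H 1 = H1 \<and> quasi_static H (gibbs \<beta>0 H0) \<omega> \<and> no_entropy_production \<omega>"
  proof (cases "vn_entropy (gibbs \<beta>0 H0) < ln CARD('n)")
    case True
    then show ?thesis
      using isentropic_trajectory_exists assms \<beta> by blast
  next
    case False
    then have max: "vn_entropy (gibbs \<beta>0 H0) = ln CARD('n)"
      using vn_entropy_gibbs_le[OF assms(1)] by (simp add: order_antisym)
    \<comment> \<open>Maximal entropy at a nonzero inverse temperature forces a scalar Hamiltonian,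
      and \<open>\<beta>\<close> transfers the maximality to \<open>H1\<close>.\<close>
    obtain r0 where "H0 = r0 *\<^sub>R mat 1"
      using max_entropy_imp_scalar[OF assms(1) _ max] assms(3) by blast
    moreover obtain r1 where "H1 = r1 *\<^sub>R mat 1"
      using max_entropy_imp_scalar[OF assms(2) _ max[unfolded \<beta>(2)]] \<beta>(1) by blast
    ultimately show ?thesis by (rule scalar_trajectory)
  qed
qed

end
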